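(* Let $E$ and $F$ be vector lattices, where $F$ is Dedekind complete. Let $\mathcal{E}$ be a vector sublattice of $\mathcal{L}_{\mathrm{ob}}(E,F)$ with the principal projection property. (1) Suppose that $ST\in\mathcal{E}$ for all $S\in\mathcal{E}$ and $T\in\mathrm{Orth}(E)$, so that there is a map $\rho_T:\mathcal{E}\to\mathcal{E}$, $\rho_T(S)=ST$, for each $T\in\mathrm{Orth}(E)$. Then $\rho_T\in\mathrm{Orth}(\mathcal{E})$ for all $T\in\mathrm{Orth}(E)$, and the map $\rho:\mathrm{Orth}(E)\to\mathrm{Orth}(\mathcal{E})$, $T\mapsto\rho_T$, is a unital vector lattice algebra homomorphism. (2) Suppose that $TS\in\mathcal{E}$ for all $S\in\mathcal{E}$ and $T\in\mathrm{Orth}(F)$, so that there is a map $\lambda_T:\mathcal{E}\to\mathcal{E}$, $\lambda_T(S)=TS$, for each $T\in\mathrm{Orth}(F)$. Then $\lambda_T\in\mathrm{Orth}(\mathcal{E})$ for all $T\in\mathrm{Orth}(F)$, and the map $\lambda:\mathrm{Orth}(F)\to\mathrm{Orth}(\mathcal{E})$, $T\mapsto\lambda_T$, is a unital vector lattice algebra homomorphism.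
   Context: All vector lattices are real and Archimedean. $\mathcal{L}_{\mathrm{ob}}(E,F)$ is the space of order bounded linear operators from $E$ into $F$, a Dedekind complete vector lattice in the operator order when $F$ is Dedekind complete. A vector lattice has the principal projection property if every band generated by a single element is a projection band. For a vector lattice $G$, $\mathrm{Orth}(G)$ is the vector lattice algebra (under composition) of orthomorphisms on $G$, i.e. of order bounded linear operators $T:G\to G$ with $T(B)\subseteq B$ for every band $B$ of $G$. A unital vector lattice algebra homomorphism is a linear, multiplicative map preserving the identity element and the lattice operations. *)

theory Defs
  imports Complex_Main "HOL-Library.Function_Algebras"
begin

text \<open>
  The spaces \<open>E\<close> and \<open>F\<close> are types. A sublattice of \<open>L_ob(E,F)\<close> is only a set of
  operators, and its order is not the order of its type, so the notions that are needed for it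
  (bands, orthomorphisms, ...) are defined for a pair \<open>G\<close>, \<open>le\<close>: a linear subspace \<open>G\<close> of some
  real vector space, and a relation \<open>le\<close> that is used on \<open>G\<close> only and makes it a vector lattice.
  The type \<open>E\<close> itself is the pair \<open>UNIV\<close>, \<open>(\<le>)\<close>.
\<close>

class archimedean_vector_lattice = ordered_real_vector + lattice +
  assumes archimedean: "0 \<le> x \<Longrightarrow> (\<And>n::nat. real n *\<^sub>R x \<le> y) \<Longrightarrow> x = 0"

text \<open>Functions form a real vector space under the pointwise operations.\<close>

instantiation "fun" :: (type, real_vector) real_vector
begin

definition scaleR_fun_def: "r *\<^sub>R f = (\<lambda>x. r *\<^sub>R f x)"

instance
  by standard (auto simp: scaleR_fun_def fun_eq_iff algebra_simps)

end

section \<open>Vector lattices on a carrier\<close>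

definition is_lub_on :: "'v set \<Rightarrow> ('v \<Rightarrow> 'v \<Rightarrow> bool) \<Rightarrow> 'v set \<Rightarrow> 'v \<Rightarrow> bool" where
  "is_lub_on G le D s \<longleftrightarrow>
     s \<in> G \<and> (\<forall>x\<in>D. le x s) \<and> (\<forall>u\<in>G. (\<forall>x\<in>D. le x u) \<longrightarrow> le s u)"

definition is_glb_on :: "'v set \<Rightarrow> ('v \<Rightarrow> 'v \<Rightarrow> bool) \<Rightarrow> 'v set \<Rightarrow> 'v \<Rightarrow> bool" where
  "is_glb_on G le D s \<longleftrightarrow>
     s \<in> G \<and> (\<forall>x\<in>D. le s x) \<and> (\<forall>u\<in>G. (\<forall>x\<in>D. le u x) \<longrightarrow> le u s)"

definition vector_sublattice ::
  "'v::real_vector set \<Rightarrow> ('v \<Rightarrow> 'v \<Rightarrow> bool) \<Rightarrow> 'v set \<Rightarrow> bool" where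
  "vector_sublattice G le M \<longleftrightarrow> M \<subseteq> G \<and> subspace M \<and>
     (\<forall>x\<in>M. \<forall>y\<in>M. (\<exists>s\<in>M. is_lub_on G le {x, y} s) \<and> (\<exists>s\<in>M. is_glb_on G le {x, y} s))"

definition vl_abs :: "'v::real_vector set \<Rightarrow> ('v \<Rightarrow> 'v \<Rightarrow> bool) \<Rightarrow> 'v \<Rightarrow> 'v" where
  "vl_abs G le x = (THE s. is_lub_on G le {x, - x} s)"

definition vl_disjoint :: "'v::real_vector set \<Rightarrow> ('v \<Rightarrow> 'v \<Rightarrow> bool) \<Rightarrow> 'v \<Rightarrow> 'v \<Rightarrow> bool" where
  "vl_disjoint G le x y \<longleftrightarrow> is_glb_on G le {vl_abs G le x, vl_abs G le y} 0"

definition order_ideal ::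
  "'v::real_vector set \<Rightarrow> ('v \<Rightarrow> 'v \<Rightarrow> bool) \<Rightarrow> 'v set \<Rightarrow> bool" where
  "order_ideal G le I \<longleftrightarrow> I \<subseteq> G \<and> subspace I \<and>
     (\<forall>x\<in>G. \<forall>y\<in>I. le (vl_abs G le x) (vl_abs G le y) \<longrightarrow> x \<in> I)"

definition band :: "'v::real_vector set \<Rightarrow> ('v \<Rightarrow> 'v \<Rightarrow> bool) \<Rightarrow> 'v set \<Rightarrow> bool" where
  "band G le B \<longleftrightarrow> order_ideal G le B \<and>
     (\<forall>D s. D \<subseteq> B \<longrightarrow> is_lub_on G le D s \<longrightarrow> s \<in> B)"

definition principal_band ::
  "'v::real_vector set \<Rightarrow> ('v \<Rightarrow> 'v \<Rightarrow> bool) \<Rightarrow> 'v \<Rightarrow> 'v set" where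
  "principal_band G le x = \<Inter> {B. band G le B \<and> x \<in> B}"

definition disjoint_complement ::
  "'v::real_vector set \<Rightarrow> ('v \<Rightarrow> 'v \<Rightarrow> bool) \<Rightarrow> 'v set \<Rightarrow> 'v set" where
  "disjoint_complement G le B = {y \<in> G. \<forall>b\<in>B. vl_disjoint G le y b}"

text \<open>Directness of the sum is automatic, as only \<open>0\<close> is disjoint from itself.\<close>

definition projection_band ::
  "'v::real_vector set \<Rightarrow> ('v \<Rightarrow> 'v \<Rightarrow> bool) \<Rightarrow> 'v set \<Rightarrow> bool" where
  "projection_band G le B \<longleftrightarrow> band G le B \<and>
     (\<forall>g\<in>G. \<exists>b\<in>B. \<exists>c\<in>disjoint_complement G le B. g = b + c)"

definition principal_projection_property ::
  "'v::real_vector set \<Rightarrow> ('v \<Rightarrow> 'v \<Rightarrow> bool) \<Rightarrow> bool" where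
  "principal_projection_property G le \<longleftrightarrow>
     (\<forall>x\<in>G. projection_band G le (principal_band G le x))"

section \<open>Operators\<close>

definition linear_map_on ::
  "'v::real_vector set \<Rightarrow> 'w::real_vector set \<Rightarrow> ('v \<Rightarrow> 'w) \<Rightarrow> bool" where
  "linear_map_on G H T \<longleftrightarrow> (\<forall>x\<in>G. T x \<in> H) \<and>
     (\<forall>x\<in>G. \<forall>y\<in>G. T (x + y) = T x + T y) \<and> (\<forall>r. \<forall>x\<in>G. T (r *\<^sub>R x) = r *\<^sub>R T x)"

text \<open>
  An operator from \<open>G\<close> into \<open>H\<close> is represented by the function that extends it by \<open>0\<close> outside
  \<open>G\<close>. Thus each operator has exactly one representative, and the vector space operations on
  operators are those of the function space.
\<close>

definition ob_ops ::
  "'v::real_vector set \<Rightarrow> ('v \<Rightarrow> 'v \<Rightarrow> bool) \<Rightarrow> 'w::real_vector set \<Rightarrow> ('w \<Rightarrow> 'w \<Rightarrow> bool)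
    \<Rightarrow> ('v \<Rightarrow> 'w) set" where
  "ob_ops G leG H leH = {T. (\<forall>x. x \<notin> G \<longrightarrow> T x = 0) \<and> linear_map_on G H T \<and>
     (\<forall>a\<in>G. \<forall>b\<in>G. \<exists>c\<in>H. \<exists>d\<in>H. \<forall>x\<in>G. leG a x \<and> leG x b \<longrightarrow> leH c (T x) \<and> leH (T x) d)}"

text \<open>The operator order; it is not the pointwise order \<open>(\<le>)\<close> that functions have in HOL.\<close>

definition op_le ::
  "'v::zero set \<Rightarrow> ('v \<Rightarrow> 'v \<Rightarrow> bool) \<Rightarrow> ('w \<Rightarrow> 'w \<Rightarrow> bool) \<Rightarrow> ('v \<Rightarrow> 'w) \<Rightarrow> ('v \<Rightarrow> 'w) \<Rightarrow> bool" where
  "op_le G leG leH S T \<longleftrightarrow> (\<forall>x\<in>G. leG 0 x \<longrightarrow> leH (S x) (T x))"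

definition Orth :: "'v::real_vector set \<Rightarrow> ('v \<Rightarrow> 'v \<Rightarrow> bool) \<Rightarrow> ('v \<Rightarrow> 'v) set" where
  "Orth G le = {T \<in> ob_ops G le G le. \<forall>B. band G le B \<longrightarrow> T ` B \<subseteq> B}"

definition id_op :: "'v::zero set \<Rightarrow> 'v \<Rightarrow> 'v" where
  "id_op G x = (if x \<in> G then x else 0)"

text \<open>
  \<open>h\<close> is a unital vector lattice algebra homomorphism between the vector lattice algebras with
  carriers \<open>A\<close> and \<open>B\<close>, orders \<open>leA\<close> and \<open>leB\<close>, products \<open>mA\<close> and \<open>mB\<close>, identities \<open>eA\<close> and \<open>eB\<close>.
  Preservation of \<open>x \<squnion> y\<close> is stated as: the supremum \<open>s\<close> of \<open>x\<close>, \<open>y\<close> in \<open>A\<close> exists, and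
  the supremum of \<open>h x\<close>, \<open>h y\<close> in \<open>B\<close> exists and is \<open>h s\<close>.
\<close>

definition unital_vla_hom ::
  "'a::real_vector set \<Rightarrow> ('a \<Rightarrow> 'a \<Rightarrow> bool) \<Rightarrow> ('a \<Rightarrow> 'a \<Rightarrow> 'a) \<Rightarrow> 'a \<Rightarrow>
   'b::real_vector set \<Rightarrow> ('b \<Rightarrow> 'b \<Rightarrow> bool) \<Rightarrow> ('b \<Rightarrow> 'b \<Rightarrow> 'b) \<Rightarrow> 'b \<Rightarrow> ('a \<Rightarrow> 'b) \<Rightarrow> bool" where
  "unital_vla_hom A leA mA eA B leB mB eB h \<longleftrightarrow>
     linear_map_on A B h \<and>
     (\<forall>x\<in>A. \<forall>y\<in>A. h (mA x y) = mB (h x) (h y)) \<and>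
     h eA = eB \<and>
     (\<forall>x\<in>A. \<forall>y\<in>A. \<exists>s. is_lub_on A leA {x, y} s \<and> is_lub_on B leB {h x, h y} (h s)) \<and>
     (\<forall>x\<in>A. \<forall>y\<in>A. \<exists>s. is_glb_on A leA {x, y} s \<and> is_glb_on B leB {h x, h y} (h s))"

definition Orth_hom ::
  "'v::real_vector set \<Rightarrow> ('v \<Rightarrow> 'v \<Rightarrow> bool) \<Rightarrow> 'w::real_vector set \<Rightarrow> ('w \<Rightarrow> 'w \<Rightarrow> bool)
    \<Rightarrow> (('v \<Rightarrow> 'v) \<Rightarrow> ('w \<Rightarrow> 'w)) \<Rightarrow> bool" where
  "Orth_hom G leG H leH h \<longleftrightarrow>
     unital_vla_hom
       (Orth G leG) (op_le G leG leG) (\<circ>) (id_op G)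
       (Orth H leH) (op_le H leH leH) (\<circ>) (id_op H) h"

abbreviation L_ob ::
  "('e::archimedean_vector_lattice \<Rightarrow> 'f::archimedean_vector_lattice) set" where
  "L_ob \<equiv> ob_ops UNIV (\<le>) UNIV (\<le>)"

abbreviation L_le ::
  "('e::archimedean_vector_lattice \<Rightarrow> 'f::archimedean_vector_lattice) \<Rightarrow> ('e \<Rightarrow> 'f) \<Rightarrow> bool" where
  "L_le \<equiv> op_le UNIV (\<le>) (\<le>)"

text \<open>The maps \<open>S \<mapsto> ST\<close> and \<open>S \<mapsto> TS\<close> on a set \<open>X\<close> of operators, extended by \<open>0\<close> as above.\<close>

definition rho :: "('e \<Rightarrow> 'f::zero) set \<Rightarrow> ('e \<Rightarrow> 'e) \<Rightarrow> ('e \<Rightarrow> 'f) \<Rightarrow> ('e \<Rightarrow> 'f)" where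
  "rho X T S = (if S \<in> X then S \<circ> T else 0)"

definition lam :: "('e \<Rightarrow> 'f::zero) set \<Rightarrow> ('f \<Rightarrow> 'f) \<Rightarrow> ('e \<Rightarrow> 'f) \<Rightarrow> ('e \<Rightarrow> 'f)" where
  "lam X T S = (if S \<in> X then T \<circ> S else 0)"

end

theory Submission
  imports Defs "HOL-Library.Lattice_Algebras"
begin

text \<open>
  Both \<open>rho X\<close> and \<open>lam X\<close> are representations of an algebra of orthomorphisms by positive operators
  on the Archimedean vector lattice \<open>X\<close>, and the conclusions hold for every unital, multiplicative and
  positive linear map \<open>h\<close> from \<open>Orth(E)\<close> into the linear operators on an Archimedean vector lattice
  \<open>G\<close> with the principal projection property. Two inequalities between orthomorphisms, transported by
  \<open>h\<close>, do the work.

  \<^item> If \<open>T \<ge> 0\<close>, then \<open>n T \<le> n\<^sup>2 I + T\<^sup>2\<close>, since squares of orthomorphisms are positive. For \<open>p \<ge> 0\<close> in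
    \<open>G\<close>, write \<open>h(T) p = u + v\<close> with \<open>u\<close> in the principal band of \<open>p\<close> and \<open>v\<close> disjoint from it. Then
    \<open>u, v \<ge> 0\<close> and \<open>n v \<le> n\<^sup>2 p + h(T\<^sup>2) p\<close>; as \<open>v\<close> and \<open>p\<close> are disjoint, \<open>n v \<le> h(T\<^sup>2) p\<close> for all \<open>n\<close>,
    so \<open>v = 0\<close>. Hence \<open>h(T)\<close> preserves bands (\<open>h_mem_principal_band\<close>).
  \<^item> If \<open>D \<ge> 0\<close>, then \<open>n (I - n D)\<^sup>+ D \<le> I\<close>. For \<open>x \<ge> 0\<close>, \<open>0 \<le> w \<le> h(C\<^sup>+) x\<close> and \<open>w \<le> h(C\<^sup>-) x\<close>, the identity
    \<open>C\<^sup>+ C\<^sup>- = 0\<close> gives \<open>h(C\<^sup>+) w = 0\<close>, and the inequality with \<open>D = C\<^sup>+\<close> gives \<open>n w \<le> x\<close> for all \<open>n\<close>, so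
    \<open>w = 0\<close>. Hence \<open>h(C\<^sup>+)\<close> and \<open>h(C\<^sup>-)\<close> are disjoint (\<open>h_pos_part_disjoint\<close>), which makes \<open>h\<close> a lattice
    homomorphism.

  This needs the structure of \<open>Orth(E)\<close> for an Archimedean vector lattice \<open>E\<close>. An orthomorphism \<open>T\<close>
  satisfies \<open>T x \<le> (T z)\<^sup>+\<close> for \<open>0 \<le> x \<le> z\<close> (\<open>orth_le_pprt\<close>); this is where order boundedness enters. It
  follows that \<open>x \<mapsto> (T x)\<^sup>+\<close> is additive on the positive cone, and its linear extension is the positive
  part of \<open>T\<close> in \<open>Orth(E)\<close>. Finally, \<open>rho X\<close> reverses products, so that its multiplicativity is the
  commutativity of \<open>Orth(E)\<close> (\<open>orth_commute\<close>).
\<close>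

section \<open>Archimedean vector lattices on a carrier\<close>

lemma is_glb_on_iff_lub_minus:
  fixes H :: "'v::ab_group_add set"
  assumes minus: "\<And>a. a \<in> H \<Longrightarrow> - a \<in> H"
    and minus_mono: "\<And>a b. a \<in> H \<Longrightarrow> b \<in> H \<Longrightarrow> r a b \<Longrightarrow> r (- b) (- a)"
    and xys: "x \<in> H" "y \<in> H" "s \<in> H"
  shows "is_glb_on H r {x, y} s \<longleftrightarrow> is_lub_on H r {- x, - y} (- s)"
proof -
  have *: "r (- a) (- b) \<longleftrightarrow> r b a" if "a \<in> H" "b \<in> H" for a b
    using minus_mono[of b a] minus_mono[of "- a" "- b"] that minus by auto
  have **: "r (- a) b \<longleftrightarrow> r (- b) a" if "a \<in> H" "b \<in> H" for a b
    using *[of a "- b"] that minus by simp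
  have "(\<forall>u\<in>H. P u) \<longleftrightarrow> (\<forall>u\<in>H. P (- u))" for P
    by (metis minus minus_minus)
  from this[of "\<lambda>u. r u x \<and> r u y \<longrightarrow> r u s"] show ?thesis
    using xys minus by (simp add: is_lub_on_def is_glb_on_def * **)
qed

locale archimedean_vector_lattice_on =
  fixes G :: "'v::real_vector set" and le :: "'v \<Rightarrow> 'v \<Rightarrow> bool"
  assumes subspace: "subspace G"
    and refl: "x \<in> G \<Longrightarrow> le x x"
    and antisym: "x \<in> G \<Longrightarrow> y \<in> G \<Longrightarrow> le x y \<Longrightarrow> le y x \<Longrightarrow> x = y"
    and trans: "x \<in> G \<Longrightarrow> y \<in> G \<Longrightarrow> z \<in> G \<Longrightarrow> le x y \<Longrightarrow> le y z \<Longrightarrow> le x z"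
    and add_right_mono: "x \<in> G \<Longrightarrow> y \<in> G \<Longrightarrow> z \<in> G \<Longrightarrow> le x y \<Longrightarrow> le (x + z) (y + z)"
    and scaleR_mono: "x \<in> G \<Longrightarrow> y \<in> G \<Longrightarrow> 0 \<le> r \<Longrightarrow> le x y \<Longrightarrow> le (r *\<^sub>R x) (r *\<^sub>R y)"
    and lub_exists: "x \<in> G \<Longrightarrow> y \<in> G \<Longrightarrow> \<exists>s. is_lub_on G le {x, y} s"
    and archimedean: "x \<in> G \<Longrightarrow> y \<in> G \<Longrightarrow> le 0 x \<Longrightarrow> (\<And>n. le (real n *\<^sub>R x) y) \<Longrightarrow> x = 0"
begin

lemma zero_mem [simp]: "0 \<in> G"
  and add_mem [simp]: "x \<in> G \<Longrightarrow> y \<in> G \<Longrightarrow> x + y \<in> G"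
  and diff_mem [simp]: "x \<in> G \<Longrightarrow> y \<in> G \<Longrightarrow> x - y \<in> G"
  and minus_mem [simp]: "x \<in> G \<Longrightarrow> - x \<in> G"
  and scaleR_mem [simp]: "x \<in> G \<Longrightarrow> r *\<^sub>R x \<in> G"
  using subspace by (auto intro: subspace_0 subspace_add subspace_diff subspace_neg subspace_scale)

lemma le_iff_diff_nonneg:
  assumes "x \<in> G" "y \<in> G"
  shows "le x y \<longleftrightarrow> le 0 (y - x)"
  using add_right_mono[of x y "- x"] add_right_mono[of 0 "y - x" x] assms by auto

lemma add_mono:
  assumes "a \<in> G" "b \<in> G" "c \<in> G" "d \<in> G" "le a b" "le c d"
  shows "le (a + c) (b + d)"
  using trans[of "a + c" "b + c" "b + d"] add_right_mono[of a b c] add_right_mono[of c d b] assms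
  by (simp add: add.commute)

lemma minus_mono: "x \<in> G \<Longrightarrow> y \<in> G \<Longrightarrow> le x y \<Longrightarrow> le (- y) (- x)"
  using add_right_mono[of x y "- x - y"] by simp

lemma diff_mono:
  assumes "a \<in> G" "b \<in> G" "c \<in> G" "d \<in> G" "le a b" "le c d"
  shows "le (a - d) (b - c)"
  using add_mono[of a b "- d" "- c"] minus_mono[of c d] assms by simp

lemma glb_exists:
  assumes "x \<in> G" "y \<in> G"
  shows "\<exists>s. is_glb_on G le {x, y} s"
proof -
  obtain s where s: "is_lub_on G le {- x, - y} s"
    using lub_exists[of "- x" "- y"] assms by auto
  then have "s \<in> G"
    by (simp add: is_lub_on_def)
  then show ?thesis
    using s is_glb_on_iff_lub_minus[of G le x y "- s"] minus_mono assms by auto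
qed

lemma vl_abs_eqI:
  assumes "is_lub_on G le {x, - x} s"
  shows "vl_abs G le x = s"
  unfolding vl_abs_def using assms by (intro the_equality) (auto simp: is_lub_on_def intro: antisym)

lemma vl_abs:
  assumes "x \<in> G"
  shows vl_abs_mem [simp]: "vl_abs G le x \<in> G"
    and vl_abs_ge: "le x (vl_abs G le x)"
    and vl_abs_ge_minus: "le (- x) (vl_abs G le x)"
    and vl_abs_least: "u \<in> G \<Longrightarrow> le x u \<Longrightarrow> le (- x) u \<Longrightarrow> le (vl_abs G le x) u"
proof -
  obtain s where s: "is_lub_on G le {x, - x} s"
    using lub_exists[of x "- x"] assms by auto
  then show "vl_abs G le x \<in> G" "le x (vl_abs G le x)" "le (- x) (vl_abs G le x)"
    "u \<in> G \<Longrightarrow> le x u \<Longrightarrow> le (- x) u \<Longrightarrow> le (vl_abs G le x) u"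
    by (auto simp: vl_abs_eqI[OF s] is_lub_on_def)
qed

lemma vl_abs_nonneg:
  assumes "x \<in> G"
  shows "le 0 (vl_abs G le x)"
proof -
  have "le 0 (vl_abs G le x + vl_abs G le x)"
    using add_mono[of x "vl_abs G le x" "- x" "vl_abs G le x"] vl_abs[OF assms] assms by simp
  from scaleR_mono[OF _ _ _ this, of "1/2"] show ?thesis
    using vl_abs_mem[OF assms] by (simp add: scaleR_add_left[symmetric] flip: scaleR_2)
qed

lemma vl_abs_of_nonneg:
  assumes "x \<in> G" "le 0 x"
  shows "vl_abs G le x = x"
proof -
  have "le (- x) x"
    using minus_mono[of 0 x] trans[of "- x" 0 x] assms by simp
  then show ?thesis
    using assms by (intro vl_abs_eqI) (auto simp: is_lub_on_def refl)
qed

lemma bandD: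
  assumes "band G le B"
  shows band_subset: "B \<subseteq> G" and band_subspace: "subspace B"
    and band_ideal: "x \<in> G \<Longrightarrow> y \<in> B \<Longrightarrow> le (vl_abs G le x) (vl_abs G le y) \<Longrightarrow> x \<in> B"
  using assms unfolding band_def order_ideal_def by auto

lemma vl_abs_mem_band:
  assumes "band G le B" "x \<in> B"
  shows "vl_abs G le x \<in> B"
proof -
  have x: "x \<in> G"
    using assms band_subset by auto
  show ?thesis
    using band_ideal[OF assms(1) _ assms(2)] vl_abs_of_nonneg[OF _ vl_abs_nonneg[OF x]]
      vl_abs_mem[OF x] refl by simp
qed

section \<open>Orthomorphisms on a carrier form an algebra\<close>

lemma OrthD:
  assumes "T \<in> Orth G le"
  shows Orth_outside: "x \<notin> G \<Longrightarrow> T x = 0"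
    and Orth_linear_map: "linear_map_on G G T"
    and Orth_mem: "x \<in> G \<Longrightarrow> T x \<in> G"
    and Orth_bounded: "a \<in> G \<Longrightarrow> b \<in> G \<Longrightarrow>
      \<exists>c\<in>G. \<exists>d\<in>G. \<forall>x\<in>G. le a x \<and> le x b \<longrightarrow> le c (T x) \<and> le (T x) d"
    and Orth_band: "band G le B \<Longrightarrow> x \<in> B \<Longrightarrow> T x \<in> B"
  using assms unfolding Orth_def ob_ops_def linear_map_on_def by blast+

lemma linear_map_on_diff:
  assumes "linear_map_on G G T" "x \<in> G" "y \<in> G"
  shows "T (x - y) = T x - T y"
proof -
  have "T (x + (-1) *\<^sub>R y) = T x + (-1) *\<^sub>R T y"
    using assms scaleR_mem[of y "-1"] unfolding linear_map_on_def by metis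
  then show ?thesis
    by simp
qed

text \<open>For positive operators order boundedness comes for free: \<open>[a, b]\<close> is mapped into \<open>[T a, T b]\<close>.\<close>

lemma OrthI_nonneg:
  assumes outside: "\<And>x. x \<notin> G \<Longrightarrow> T x = 0" and lin: "linear_map_on G G T"
    and pos: "\<And>x. x \<in> G \<Longrightarrow> le 0 x \<Longrightarrow> le 0 (T x)"
    and band: "\<And>B x. band G le B \<Longrightarrow> x \<in> B \<Longrightarrow> T x \<in> B"
  shows "T \<in> Orth G le"
proof -
  have mem: "T x \<in> G" if "x \<in> G" for x
    using lin that unfolding linear_map_on_def by blast
  have mono: "le (T x) (T y)" if "x \<in> G" "y \<in> G" "le x y" for x y
    using that pos[of "y - x"] le_iff_diff_nonneg[of x y] le_iff_diff_nonneg[of "T x" "T y"]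
      mem linear_map_on_diff[OF lin, of y x] by simp
  have "\<exists>c\<in>G. \<exists>d\<in>G. \<forall>x\<in>G. le a x \<and> le x b \<longrightarrow> le c (T x) \<and> le (T x) d"
    if "a \<in> G" "b \<in> G" for a b
    by (rule bexI[of _ "T a"], rule bexI[of _ "T b"]) (use that mono mem in auto)
  then show ?thesis
    using outside lin band by (auto simp: Orth_def ob_ops_def)
qed

lemma Orth_add:
  assumes A: "A \<in> Orth G le" and B: "B \<in> Orth G le"
  shows "A + B \<in> Orth G le"
proof -
  have "\<exists>c\<in>G. \<exists>d\<in>G. \<forall>x\<in>G. le a x \<and> le x b \<longrightarrow> le c ((A + B) x) \<and> le ((A + B) x) d"
    if ab: "a \<in> G" "b \<in> G" for a b
  proof -
    obtain c d where 1: "c \<in> G" "d \<in> G" "\<forall>x\<in>G. le a x \<and> le x b \<longrightarrow> le c (A x) \<and> le (A x) d"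
      using Orth_bounded[OF A ab] by blast
    obtain c' d' where 2: "c' \<in> G" "d' \<in> G" "\<forall>x\<in>G. le a x \<and> le x b \<longrightarrow> le c' (B x) \<and> le (B x) d'"
      using Orth_bounded[OF B ab] by blast
    show ?thesis
      by (rule bexI[of _ "c + c'"], rule bexI[of _ "d + d'"])
        (use 1 2 Orth_mem[OF A] Orth_mem[OF B] in \<open>auto intro!: add_mono\<close>)
  qed
  moreover have "linear_map_on G G (A + B)"
    using Orth_linear_map[OF A] Orth_linear_map[OF B]
    by (auto simp: linear_map_on_def algebra_simps)
  ultimately show ?thesis
    using Orth_outside[OF A] Orth_outside[OF B] Orth_band[OF A] Orth_band[OF B]
    by (auto simp: Orth_def ob_ops_def intro: subspace_add[OF band_subspace])
qed

lemma Orth_scaleR: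
  assumes A: "A \<in> Orth G le"
  shows "r *\<^sub>R A \<in> Orth G le"
proof -
  have "\<exists>c\<in>G. \<exists>d\<in>G. \<forall>x\<in>G. le a x \<and> le x b \<longrightarrow> le c ((r *\<^sub>R A) x) \<and> le ((r *\<^sub>R A) x) d"
    if ab: "a \<in> G" "b \<in> G" for a b
  proof -
    obtain c d where 1: "c \<in> G" "d \<in> G" "\<forall>x\<in>G. le a x \<and> le x b \<longrightarrow> le c (A x) \<and> le (A x) d"
      using Orth_bounded[OF A ab] by blast
    show ?thesis
    proof (cases "0 \<le> r")
      case True
      show ?thesis
        by (rule bexI[of _ "r *\<^sub>R c"], rule bexI[of _ "r *\<^sub>R d"])
          (use 1 True Orth_mem[OF A] in \<open>auto intro!: scaleR_mono simp: scaleR_fun_def\<close>)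
    next
      case False
      have neg: "le (r *\<^sub>R y) (r *\<^sub>R x)" if "x \<in> G" "y \<in> G" "le x y" for x y
        using minus_mono[OF _ _ scaleR_mono[of x y "- r"]] that False by simp
      show ?thesis
        by (rule bexI[of _ "r *\<^sub>R d"], rule bexI[of _ "r *\<^sub>R c"])
          (use 1 Orth_mem[OF A] in \<open>auto intro!: neg simp: scaleR_fun_def\<close>)
    qed
  qed
  moreover have "linear_map_on G G (r *\<^sub>R A)"
    using Orth_linear_map[OF A]
    by (auto simp: linear_map_on_def scaleR_fun_def algebra_simps)
  ultimately show ?thesis
    using Orth_outside[OF A] Orth_band[OF A]
    by (auto simp: Orth_def ob_ops_def scaleR_fun_def intro: subspace_scale[OF band_subspace])
qed

lemma Orth_minus: "A \<in> Orth G le \<Longrightarrow> - A \<in> Orth G le"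
  using Orth_scaleR[of A "-1"] by simp

lemma Orth_glb_iff_lub_minus:
  assumes "A \<in> Orth G le" "B \<in> Orth G le" "S \<in> Orth G le"
  shows "is_glb_on (Orth G le) (op_le G le le) {A, B} S \<longleftrightarrow>
    is_lub_on (Orth G le) (op_le G le le) {- A, - B} (- S)"
proof (rule is_glb_on_iff_lub_minus[OF Orth_minus _ assms])
  fix S T
  assume "S \<in> Orth G le" "T \<in> Orth G le" "op_le G le le S T"
  then show "op_le G le le (- T) (- S)"
    by (simp add: op_le_def minus_mono Orth_mem)
qed

lemma Orth_diff: "A \<in> Orth G le \<Longrightarrow> B \<in> Orth G le \<Longrightarrow> A - B \<in> Orth G le"
  using Orth_add[of A "- B"] Orth_minus by simp

lemma Orth_comp:
  assumes A: "A \<in> Orth G le" and B: "B \<in> Orth G le"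
  shows "A \<circ> B \<in> Orth G le"
proof -
  have "\<exists>c\<in>G. \<exists>d\<in>G. \<forall>x\<in>G. le a x \<and> le x b \<longrightarrow> le c (A (B x)) \<and> le (A (B x)) d"
    if ab: "a \<in> G" "b \<in> G" for a b
  proof -
    obtain c d where 1: "c \<in> G" "d \<in> G" "\<forall>x\<in>G. le a x \<and> le x b \<longrightarrow> le c (B x) \<and> le (B x) d"
      using Orth_bounded[OF B ab] by blast
    show ?thesis
      using Orth_bounded[OF A 1(1,2)] 1(3) Orth_mem[OF B] by meson
  qed
  moreover have "linear_map_on G G (A \<circ> B)"
    using Orth_linear_map[OF A] Orth_linear_map[OF B] by (auto simp: linear_map_on_def)
  moreover have "A 0 = 0"
    using linear_map_on_diff[OF Orth_linear_map[OF A], of 0 0] by simp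
  ultimately show ?thesis
    using Orth_outside[OF A] Orth_outside[OF B] Orth_band[OF A] Orth_band[OF B]
    by (auto simp: Orth_def ob_ops_def)
qed

lemma Orth_id: "id_op G \<in> Orth G le"
  by (rule OrthI_nonneg) (use band_subset in \<open>auto simp: id_op_def linear_map_on_def\<close>)

end

section \<open>Positive parts and disjointness\<close>

subclass (in archimedean_vector_lattice) lattice_ab_group_add ..

definition modulus :: "'a::archimedean_vector_lattice \<Rightarrow> 'a" where
  "modulus x = sup x (- x)"

definition disjoint :: "'a::archimedean_vector_lattice \<Rightarrow> 'a \<Rightarrow> bool" where
  "disjoint x y \<longleftrightarrow> inf (modulus x) (modulus y) = 0"

context
  fixes x y z u v :: "'a::archimedean_vector_lattice"
begin

lemma pprt_diff_eq: "pprt x - pprt (- x) = x"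
  using prts[of x] by (simp add: pprt_neg)

lemma pprt_disjoint: "inf (pprt x) (pprt (- x)) = 0"
proof -
  have "inf (pprt x) (pprt (- x)) = inf x 0 + pprt (- x)"
    using add_inf_distrib_right[of x 0 "pprt (- x)"] pprt_diff_eq
    by (simp add: algebra_simps)
  also have "\<dots> = 0"
    by (simp add: pprt_neg nprt_def[symmetric])
  finally show ?thesis .
qed

lemma pprt_least: "x \<le> y \<Longrightarrow> 0 \<le> y \<Longrightarrow> pprt x \<le> y"
  by (simp add: pprt_def)

lemma pprt_ge: "x \<le> pprt x"
  by (simp add: pprt_def)

lemma add_eq_sup_if_inf_zero: "inf x y = 0 \<Longrightarrow> x + y = sup x y"
  using add_eq_inf_sup[of x y] by simp

lemma inf_zero_add:
  assumes "inf x y = 0" "inf x z = 0"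
  shows "inf x (y + z) = 0"
proof (rule order.antisym)
  have *: "0 \<le> x" "0 \<le> y" "0 \<le> z"
    using assms by (metis inf.cobounded1 inf.cobounded2)+
  let ?w = "inf x (y + z)"
  have "?w - z \<le> inf x y"
    using * by (simp add: diff_le_eq le_infI1 add_increasing2)
  then have "?w \<le> z"
    using assms by simp
  then show "?w \<le> 0"
    using assms by (metis inf.cobounded1 le_inf_iff)
  show "0 \<le> ?w"
    using * by simp
qed

lemma inf_zero_mono:
  assumes "inf x y = 0" "0 \<le> u" "u \<le> x" "0 \<le> v" "v \<le> y"
  shows "inf u v = 0"
  using assms inf_mono[of u x v y] by (intro order.antisym) auto

lemma modulus_least: "x \<le> y \<Longrightarrow> - x \<le> y \<Longrightarrow> modulus x \<le> y"
  by (simp add: modulus_def)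

lemma modulus_ge: "x \<le> modulus x" "- x \<le> modulus x"
  by (simp_all add: modulus_def)

lemma modulus_minus [simp]: "modulus (- x) = modulus x"
  by (simp add: modulus_def sup.commute)

lemma modulus_nonneg [simp]: "0 \<le> modulus x"
proof -
  have "x + - x \<le> modulus x + modulus x"
    by (intro add_mono modulus_ge)
  then show ?thesis by simp
qed

end

lemma modulus_eq: "modulus x = pprt x + pprt (- x)"
proof (rule order.antisym)
  show "modulus x \<le> pprt x + pprt (- x)"
    by (intro modulus_least add_increasing2 add_increasing pprt_ge) auto
  have "pprt x \<le> modulus x" "pprt (- x) \<le> modulus x"
    by (auto simp: pprt_def modulus_ge)
  then show "pprt x + pprt (- x) \<le> modulus x"
    by (simp add: add_eq_sup_if_inf_zero[OF pprt_disjoint])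
qed

lemma modulus_of_nonneg [simp]: "0 \<le> x \<Longrightarrow> modulus x = x"
  by (simp add: modulus_eq)

lemma inf_zero_modulus [simp]: "inf 0 (modulus x) = 0"
  by (simp add: inf_absorb1)

lemma modulus_diff: "modulus (x - y) \<le> modulus x + modulus y"
proof (rule modulus_least)
  show "x - y \<le> modulus x + modulus y"
    using add_mono[OF modulus_ge(1)[of x] modulus_ge(2)[of y]] by simp
  show "- (x - y) \<le> modulus x + modulus y"
    using add_mono[OF modulus_ge(2)[of x] modulus_ge(1)[of y]] by simp
qed

lemma modulus_add: "modulus (x + y) \<le> modulus x + modulus y"
  using modulus_diff[of x "- y"] by simp

lemma modulus_scaleR:
  fixes x :: "'a::archimedean_vector_lattice"
  shows "modulus (r *\<^sub>R x) \<le> \<bar>r\<bar> *\<^sub>R modulus x"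
proof (cases "0 \<le> r")
  case True
  then show ?thesis
    using scaleR_left_mono[OF modulus_ge(1)[of x] True] scaleR_left_mono[OF modulus_ge(2)[of x] True]
    by (intro modulus_least) auto
next
  case False
  then have r: "0 \<le> - r" by simp
  show ?thesis
    using scaleR_left_mono[OF modulus_ge(1)[of x] r] scaleR_left_mono[OF modulus_ge(2)[of x] r] False
    by (intro modulus_least) auto
qed

lemma disjoint_commute: "disjoint x y \<longleftrightarrow> disjoint y x"
  by (simp add: disjoint_def inf.commute)

lemma disjoint_mono:
  assumes "disjoint x y" "modulus u \<le> modulus x" "modulus v \<le> modulus y"
  shows "disjoint u v"
  using assms inf_zero_mono[of "modulus x" "modulus y"] by (simp add: disjoint_def)

lemma disjoint_self: "disjoint x x \<Longrightarrow> x = 0"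
  by (simp add: disjoint_def)
    (metis modulus_def sup_0_eq_0)

lemma disjoint_add:
  assumes "disjoint x z" "disjoint y z"
  shows "disjoint (x + y) z"
proof -
  have "inf (modulus z) (modulus x + modulus y) = 0"
    using assms by (intro inf_zero_add) (simp_all add: disjoint_def inf.commute)
  then have "inf (modulus z) (modulus (x + y)) = 0"
    by (rule inf_zero_mono) (simp_all add: modulus_add)
  then show ?thesis
    by (simp add: disjoint_def inf.commute)
qed

lemma disjoint_scaleR:
  assumes "disjoint x z"
  shows "disjoint (r *\<^sub>R x) z"
proof -
  obtain n :: nat where n: "\<bar>r\<bar> \<le> real n"
    using real_arch_simple by blast
  have "disjoint (real n *\<^sub>R x) z" for n :: nat
  proof (induction n)
    case 0
    then show ?case
      by (simp add: disjoint_def inf_absorb1)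
  next
    case (Suc n)
    then show ?case
      using disjoint_add[OF assms] by (simp add: scaleR_add_left)
  qed
  moreover have "modulus (r *\<^sub>R x) \<le> modulus (real n *\<^sub>R x)"
  proof -
    have "real n *\<^sub>R modulus x \<le> modulus (real n *\<^sub>R x)"
      using modulus_scaleR[of "inverse (real n)" "real n *\<^sub>R x"]
        scaleR_left_mono[of "modulus x" "inverse (real n) *\<^sub>R modulus (real n *\<^sub>R x)" "real n"]
      by (cases "n = 0") simp_all
    then show ?thesis
      using modulus_scaleR[of r x] scaleR_right_mono[OF n modulus_nonneg[of x]] by order
  qed
  ultimately show ?thesis
    using disjoint_mono[of "real n *\<^sub>R x"] by blast
qed

lemma disjoint_iff_inf: "0 \<le> x \<Longrightarrow> 0 \<le> y \<Longrightarrow> disjoint x y \<longleftrightarrow> inf x y = 0"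
  by (simp add: disjoint_def)

lemma disjoint_pprt_pprt_minus: "disjoint (pprt x) (pprt (- x))"
  by (simp add: disjoint_iff_inf pprt_disjoint)

lemma modulus_pprt_le: "modulus (pprt x) \<le> modulus x"
  by (simp add: modulus_eq)

text \<open>With \<open>p = x\<^sup>+ + y\<^sup>+\<close> and \<open>q = x\<^sup>- + y\<^sup>-\<close>, the assumptions make \<open>p\<close> and \<open>q\<close> disjoint, and
  a difference of disjoint positive elements is its decomposition into positive and negative part.\<close>

lemma pprt_add_eq:
  assumes "inf (pprt x) (pprt (- y)) = 0" "inf (pprt y) (pprt (- x)) = 0"
  shows "pprt (x + y) = pprt x + pprt (y :: 'a::archimedean_vector_lattice)"
proof -
  let ?p = "pprt x + pprt y" and ?q = "pprt (- x) + pprt (- y)"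
  have "inf ?q (pprt x) = 0" "inf ?q (pprt y) = 0"
    using inf_zero_add[of "pprt x"] inf_zero_add[of "pprt y"] assms pprt_disjoint[of x] pprt_disjoint[of y]
    by (simp_all add: inf.commute)
  then have "inf ?q ?p = 0"
    by (rule inf_zero_add)
  moreover have "sup (?p - ?q) 0 = ?p - inf ?q ?p"
    by (simp only: diff_inf_eq_sup add_sup_distrib_left) (simp add: algebra_simps)
  moreover have "?p - ?q = x + y"
    using pprt_diff_eq[of x] pprt_diff_eq[of y] by (simp add: algebra_simps)
  ultimately show ?thesis
    by (simp add: pprt_def)
qed

lemma pprt_scaleR:
  fixes x :: "'a::archimedean_vector_lattice"
  assumes "0 \<le> r"
  shows "pprt (r *\<^sub>R x) = r *\<^sub>R pprt x"
proof (cases "r = 0")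
  case False
  have le: "pprt (s *\<^sub>R y) \<le> s *\<^sub>R pprt y" if "0 \<le> s" for s and y :: 'a
    using that by (intro pprt_least scaleR_left_mono pprt_ge scaleR_nonneg_nonneg) auto
  have "r *\<^sub>R pprt (inverse r *\<^sub>R (r *\<^sub>R x)) \<le> r *\<^sub>R (inverse r *\<^sub>R pprt (r *\<^sub>R x))"
    using assms by (intro scaleR_left_mono le) auto
  then show ?thesis
    using le[OF assms, of x] False by (intro order.antisym) auto
qed simp

lemma eq_zero_if_le_scaleR:
  fixes x y :: "'a::archimedean_vector_lattice"
  assumes "0 \<le> x" and "\<And>n::nat. 0 < n \<Longrightarrow> x \<le> (1 / real n) *\<^sub>R y"
  shows "x = 0"
proof (rule archimedean[OF assms(1)])
  show "real n *\<^sub>R x \<le> y" for n :: nat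
  proof (cases "n = 0")
    case True
    then show ?thesis
      using assms(1) assms(2)[of 1] by simp
  next
    case False
    then show ?thesis
      using scaleR_left_mono[OF assms(2)[of n], of "real n"] by simp
  qed
qed

section \<open>Positive parts of orthomorphisms\<close>

interpretation univ: archimedean_vector_lattice_on
  "UNIV :: 'a::archimedean_vector_lattice set" "(\<le>)"
proof
  show "\<exists>s. is_lub_on UNIV (\<le>) {x, y} s" for x y :: 'a
    by (rule exI[of _ "sup x y"]) (auto simp: is_lub_on_def)
  show "x = 0" if "0 \<le> x" "\<And>n. real n *\<^sub>R x \<le> y" for x y :: 'a
    using archimedean that by blast
qed (auto intro: scaleR_left_mono)

abbreviation orth :: "('a::archimedean_vector_lattice \<Rightarrow> 'a) set" where
  "orth \<equiv> Orth UNIV (\<le>)"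

lemma vl_abs_UNIV [simp]: "vl_abs UNIV (\<le>) x = modulus x"
  by (rule univ.vl_abs_eqI) (auto simp: is_lub_on_def modulus_def)

text \<open>The point is that \<open>y\<^sup>d\<close> contains the suprema of its subsets: for \<open>w = s\<^sup>+ \<and> |y|\<close> and \<open>d\<close> in
  the set, \<open>d\<^sup>+\<close> and \<open>w\<close> are disjoint and lie below \<open>s\<^sup>+\<close>, so \<open>d\<^sup>+ + w \<le> s\<^sup>+\<close>; as \<open>s\<^sup>- \<le> d\<^sup>-\<close>,
  also \<open>s - w\<close> is an upper bound.\<close>

lemma band_disjoint: "band UNIV (\<le>) {x :: 'a::archimedean_vector_lattice. disjoint x y}"
proof -
  have "s \<in> {x. disjoint x y}"
    if D: "D \<subseteq> {x. disjoint x y}" and s: "is_lub_on UNIV (\<le>) D s" for D and s :: 'a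
  proof -
    have ub: "d \<le> s" if "d \<in> D" for d
      using s that by (simp add: is_lub_on_def)
    have least: "s \<le> u" if "\<And>d. d \<in> D \<Longrightarrow> d \<le> u" for u
      using s that by (simp add: is_lub_on_def)
    let ?w = "inf (pprt s) (modulus y)"
    have "d \<le> s - ?w" if "d \<in> D" for d
    proof -
      have "inf (pprt d) (modulus y) = 0"
        using D that disjoint_mono[of d y "pprt d" y] modulus_pprt_le[of d] by (auto simp: disjoint_def)
      then have "inf (pprt d) ?w = 0"
        by (rule inf_zero_mono) auto
      then have "pprt d + ?w = sup (pprt d) ?w"
        by (rule add_eq_sup_if_inf_zero)
      also have "\<dots> \<le> pprt s"
        using ub[OF that] by simp
      finally have "pprt d + ?w - pprt (- d) \<le> pprt s - pprt (- s)"
        using ub[OF that] by (intro diff_mono) auto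
      then show ?thesis
        using pprt_diff_eq[of d] pprt_diff_eq[of s] by (metis add_diff_eq diff_add_eq le_diff_eq)
    qed
    from least[OF this] have "?w \<le> 0"
      by (simp only: le_diff_eq) simp
    then have "?w = 0"
      by (intro order.antisym) auto
    moreover have "inf (pprt (- s)) (modulus y) = 0"
    proof (cases "D = {}")
      case True
      then have "s \<le> 0" "s \<le> s + s"
        using least by blast+
      then have "s = 0"
        by (intro order.antisym) auto
      then show ?thesis
        by simp
    next
      case False
      then obtain d where d: "d \<in> D"
        by blast
      then have "disjoint d y"
        using D by auto
      moreover have "pprt (- s) \<le> modulus d"
        using ub[OF d] modulus_ge[of d] by (intro pprt_least) (auto intro: order.trans[of _ "- d"])
      ultimately show ?thesis
        using inf_zero_mono[of "modulus d" "modulus y"] by (simp add: disjoint_def)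
    qed
    ultimately have "inf (modulus y) (pprt s + pprt (- s)) = 0"
      by (intro inf_zero_add) (simp_all add: inf.commute)
    then show ?thesis
      by (simp add: disjoint_def modulus_eq inf.commute)
  qed
  moreover have "order_ideal UNIV (\<le>) {x. disjoint x y}"
    unfolding order_ideal_def
    by (auto intro: subspaceI disjoint_add disjoint_scaleR disjoint_mono simp: disjoint_def[of 0])
  ultimately show ?thesis
    unfolding band_def by blast
qed

lemma orth_disjoint: "T \<in> orth \<Longrightarrow> disjoint x y \<Longrightarrow> disjoint (T x) y"
  using univ.Orth_band[OF _ band_disjoint[of y], of T x] by simp

lemma orth_linear: "T \<in> orth \<Longrightarrow> linear T"
  using univ.Orth_linear_map[of T] by (auto simp: linear_map_on_def intro: linearI)

lemma orthI_nonneg: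
  assumes "linear T" "\<And>x. 0 \<le> x \<Longrightarrow> 0 \<le> T x" "\<And>B x. band UNIV (\<le>) B \<Longrightarrow> x \<in> B \<Longrightarrow> T x \<in> B"
  shows "T \<in> orth"
  by (rule univ.OrthI_nonneg) (use assms in \<open>auto simp: linear_map_on_def linear_add linear_scale\<close>)

text \<open>By induction on \<open>m\<close>: \<open>x - e\<close> has disjoint positive and negative parts, so \<open>T x - T e\<close> is the
  difference of the disjoint elements \<open>T ((x - e)\<^sup>+)\<close>, to which the induction hypothesis applies,
  and \<open>T ((e - x)\<^sup>+)\<close>, where \<open>e - (e - x)\<^sup>+ = x \<and> e\<close> lies in \<open>[0, e]\<close>. A difference of disjoint
  elements is below the supremum of its two contributions, so the error \<open>v\<close> is not added up.\<close>

lemma orth_le_layers: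
  assumes T: "T \<in> orth" and v: "\<And>u. 0 \<le> u \<Longrightarrow> u \<le> e \<Longrightarrow> T u \<le> v" and e: "0 \<le> e"
    and x: "0 \<le> x" "x \<le> real m *\<^sub>R e"
  shows "T x \<le> real m *\<^sub>R pprt (T e) + v"
  using x
proof (induction m arbitrary: x)
  case 0
  then have "x = 0"
    by simp
  then show ?case
    using v[of 0] e by (simp add: linear_0[OF orth_linear[OF T]])
next
  case (Suc m)
  note lin = linear_add[OF orth_linear[OF T]] linear_diff[OF orth_linear[OF T]]
  let ?s = "T (pprt (x - e))" and ?d = "T (pprt (e - x))"
  have "0 \<le> v"
    using v[of 0] e by (simp add: linear_0[OF orth_linear[OF T]])
  have "?s \<le> real m *\<^sub>R pprt (T e) + v"
    using Suc.prems e by (intro Suc.IH pprt_least) (auto simp: algebra_simps intro: scaleR_nonneg_nonneg)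
  then have s: "pprt ?s \<le> real m *\<^sub>R pprt (T e) + v"
    using \<open>0 \<le> v\<close> by (intro pprt_least add_nonneg_nonneg scaleR_nonneg_nonneg) auto
  have "T (e - pprt (e - x)) \<le> v"
    using Suc.prems e pprt_ge[of "e - x"] by (intro v) (auto intro: pprt_least simp: algebra_simps)
  then have d: "T e - ?d \<le> v"
    by (simp add: lin)
  have "disjoint ?s ?d"
    using disjoint_pprt_pprt_minus[of "x - e"] orth_disjoint[OF T] disjoint_commute
    by (metis minus_diff_eq)
  then have "inf (pprt ?s) (pprt (- ?d)) = 0"
    using inf_zero_mono[of "modulus ?s" "modulus ?d" "pprt ?s" "pprt (- ?d)"]
    by (simp add: disjoint_def modulus_eq)
  then have "?s - ?d \<le> sup (pprt ?s) (pprt (- ?d))"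
    using add_mono[OF pprt_ge[of ?s] pprt_ge[of "- ?d"]] add_eq_sup_if_inf_zero by force
  moreover have "T x = T e + (?s - ?d)"
  proof -
    have "x = e + pprt (x - e) - pprt (e - x)"
      using pprt_diff_eq[of "x - e"] by (simp add: algebra_simps)
    then show ?thesis
      by (metis lin add_diff_eq)
  qed
  ultimately have "T x \<le> T e + sup (pprt ?s) (pprt (- ?d))"
    by simp
  also have "\<dots> = sup (T e + pprt ?s) (sup (T e - ?d) (T e))"
    unfolding pprt_def[of "- ?d"] by (simp add: add_sup_distrib_left)
  also have "\<dots> \<le> pprt (T e) + (real m *\<^sub>R pprt (T e) + v)"
  proof (intro sup_least)
    have nonneg: "0 \<le> real m *\<^sub>R pprt (T e)"
      by (intro scaleR_nonneg_nonneg) auto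
    show "T e + pprt ?s \<le> pprt (T e) + (real m *\<^sub>R pprt (T e) + v)"
      by (intro add_mono pprt_ge s)
    show "T e \<le> pprt (T e) + (real m *\<^sub>R pprt (T e) + v)"
      using nonneg \<open>0 \<le> v\<close> by (intro add_increasing2 pprt_ge) auto
    show "T e - ?d \<le> pprt (T e) + (real m *\<^sub>R pprt (T e) + v)"
      using nonneg d by (intro add_increasing) auto
  qed
  also have "\<dots> = real (Suc m) *\<^sub>R pprt (T e) + v"
    by (simp add: algebra_simps)
  finally show ?case .
qed

text \<open>Cut \<open>[0, z]\<close> into \<open>n\<close> layers of height \<open>z / n\<close>. If \<open>w\<close> bounds \<open>T\<close> on \<open>[0, z]\<close>, then \<open>w / n\<close>
  bounds \<open>T\<close> on each layer, so the preceding lemma gives \<open>T x \<le> (T z)\<^sup>+ + w / n\<close>.\<close>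

lemma orth_le_pprt:
  assumes T: "T \<in> orth" and x: "0 \<le> x" "x \<le> z"
  shows "T x \<le> pprt (T z)"
proof -
  have z: "0 \<le> z"
    using x by order
  obtain w where w: "\<And>u. 0 \<le> u \<Longrightarrow> u \<le> z \<Longrightarrow> T u \<le> w"
    using univ.Orth_bounded[OF T, of 0 z] by auto
  have "pprt (T x - pprt (T z)) \<le> (1 / real n) *\<^sub>R w" if n: "0 < n" for n :: nat
  proof (rule pprt_least)
    have "T u \<le> (1 / real n) *\<^sub>R w" if "0 \<le> u" "u \<le> (1 / real n) *\<^sub>R z" for u
    proof -
      have "T (real n *\<^sub>R u) \<le> w"
        using that n scaleR_left_mono[of u "(1 / real n) *\<^sub>R z" "real n"] by (intro w) (auto intro: scaleR_nonneg_nonneg)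
      then have "(1 / real n) *\<^sub>R (real n *\<^sub>R T u) \<le> (1 / real n) *\<^sub>R w"
        by (intro scaleR_left_mono) (auto simp: linear_scale[OF orth_linear[OF T]])
      then show ?thesis
        using n by simp
    qed
    moreover have "0 \<le> (1 / real n) *\<^sub>R z"
      using z by (intro scaleR_nonneg_nonneg) auto
    moreover have "x \<le> real n *\<^sub>R ((1 / real n) *\<^sub>R z)"
      using x n by simp
    ultimately have "T x \<le> real n *\<^sub>R pprt (T ((1 / real n) *\<^sub>R z)) + (1 / real n) *\<^sub>R w"
      using orth_le_layers[OF T _ _ x(1)] by blast
    then show "T x - pprt (T z) \<le> (1 / real n) *\<^sub>R w"
      using n by (simp add: linear_scale[OF orth_linear[OF T]] pprt_scaleR algebra_simps)
    show "0 \<le> (1 / real n) *\<^sub>R w"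
      using w[of 0] z by (intro scaleR_nonneg_nonneg) (simp_all add: linear_0[OF orth_linear[OF T]])
  qed
  from eq_zero_if_le_scaleR[OF _ this] show ?thesis
    using pprt_ge[of "T x - pprt (T z)"] by simp
qed

text \<open>By \<open>orth_le_pprt\<close> for \<open>T\<close> and for \<open>- T\<close>, the two elements lie below the positive and the negative
  part of the single element \<open>T (x + y)\<close>.\<close>

lemma orth_pprt_disjoint:
  assumes T: "T \<in> orth" and "0 \<le> x" "0 \<le> y"
  shows "inf (pprt (T x)) (pprt (- T y)) = 0"
proof -
  have "pprt (T x) \<le> pprt (T (x + y))"
    using assms by (intro pprt_least orth_le_pprt[OF T]) auto
  moreover have "pprt (- T y) \<le> pprt (- T (x + y))"
    using assms orth_le_pprt[OF univ.Orth_minus[OF T], of y "x + y"] by (intro pprt_least) auto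
  ultimately show ?thesis
    by (intro inf_zero_mono[OF pprt_disjoint]) auto
qed

text \<open>For an orthomorphism \<open>T\<close>, this is the linear extension of \<open>x \<mapsto> (T x)\<^sup>+\<close> from the positive cone.\<close>

definition pos_part :: "('a::archimedean_vector_lattice \<Rightarrow> 'a) \<Rightarrow> 'a \<Rightarrow> 'a" where
  "pos_part T x = pprt (T (pprt x)) - pprt (T (pprt (- x)))"

context
  fixes T :: "'a::archimedean_vector_lattice \<Rightarrow> 'a"
  assumes T: "T \<in> orth"
begin

interpretation linear T
  by (rule orth_linear[OF T])

lemma pos_part_of_nonneg: "0 \<le> x \<Longrightarrow> pos_part T x = pprt (T x)"
  using zero by (simp add: pos_part_def)

lemma pprt_orth_add: "0 \<le> x \<Longrightarrow> 0 \<le> y \<Longrightarrow> pprt (T (x + y)) = pprt (T x) + pprt (T y)"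
  using orth_pprt_disjoint[OF T] by (simp add: add pprt_add_eq)

lemma pos_part_linear: "linear (pos_part T)"
proof (rule linearI)
  fix x y :: 'a and r
  have "pprt (x + y) + pprt (- x) + pprt (- y) = pprt (- (x + y)) + pprt x + pprt y"
    using pprt_diff_eq[of x] pprt_diff_eq[of y] pprt_diff_eq[of "x + y"] by (simp add: algebra_simps)
  from arg_cong[OF this, of "\<lambda>z. pprt (T z)"]
  have "pprt (T (pprt (x + y))) + pprt (T (pprt (- x))) + pprt (T (pprt (- y))) =
    pprt (T (pprt (- (x + y)))) + pprt (T (pprt x)) + pprt (T (pprt y))"
    by (simp only: pprt_orth_add zero_le_pprt add_nonneg_nonneg)
  then show "pos_part T (x + y) = pos_part T x + pos_part T y"
    unfolding pos_part_def by (simp only: diff_eq_eq eq_diff_eq add_diff_eq diff_add_eq ac_simps)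
  show "pos_part T (r *\<^sub>R x) = r *\<^sub>R pos_part T x"
  proof (cases "0 \<le> r")
    case True
    then show ?thesis
      using pprt_scaleR[OF True, of x] pprt_scaleR[OF True, of "- x"]
      by (simp add: pos_part_def scale pprt_scaleR algebra_simps)
  next
    case False
    then have r: "0 \<le> - r"
      by simp
    have "pprt (r *\<^sub>R x) = (- r) *\<^sub>R pprt (- x)" "pprt (- (r *\<^sub>R x)) = (- r) *\<^sub>R pprt x"
      using pprt_scaleR[OF r, of x] pprt_scaleR[OF r, of "- x"] by simp_all
    then show ?thesis
      using r by (simp only: pos_part_def scale pprt_scaleR[OF r]) (simp add: algebra_simps)
  qed
qed

lemma pos_part_orth: "pos_part T \<in> orth"
proof (rule orthI_nonneg[OF pos_part_linear])
  show "0 \<le> pos_part T x" if "0 \<le> x" for x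
    using that by (simp add: pos_part_of_nonneg)
  fix B and x :: 'a
  assume B: "band UNIV (\<le>) B" and x: "x \<in> B"
  have "T (modulus x) \<in> B"
    using univ.Orth_band[OF T B] univ.vl_abs_mem_band[OF B x] by simp
  moreover have "modulus (pos_part T x) \<le> pprt (T (pprt x)) + pprt (T (pprt (- x)))"
    using modulus_diff[of "pprt (T (pprt x))" "pprt (T (pprt (- x)))"] by (simp add: pos_part_def)
  then have "modulus (pos_part T x) \<le> pprt (T (modulus x))"
    by (simp add: pprt_orth_add[symmetric] modulus_eq[symmetric])
  then have "modulus (pos_part T x) \<le> modulus (T (modulus x))"
    using modulus_pprt_le[of "T (modulus x)"] by simp
  ultimately show "pos_part T x \<in> B"
    using univ.band_ideal[OF B] by simp
qed

lemma pos_part_diff_pos_part_minus: "pos_part T x - pos_part (- T) x = T x"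
proof -
  have "pos_part T x - pos_part (- T) x = T (pprt x) - T (pprt (- x))"
    using arg_cong2[of _ _ _ _ minus, OF pprt_diff_eq[of "T (pprt x)"] pprt_diff_eq[of "T (pprt (- x))"]]
    by (simp add: pos_part_def algebra_simps)
  also have "\<dots> = T x"
    by (metis diff pprt_diff_eq)
  finally show ?thesis .
qed

end

section \<open>Inequalities between orthomorphisms\<close>

definition pos_orth :: "('a::archimedean_vector_lattice \<Rightarrow> 'a) set" where
  "pos_orth = {T \<in> orth. \<forall>x\<ge>0. 0 \<le> T x}"

lemma pos_orthD:
  assumes "T \<in> pos_orth"
  shows pos_orth_orth: "T \<in> orth" and pos_orth_nonneg: "0 \<le> x \<Longrightarrow> 0 \<le> T x"
    and pos_orth_linear: "linear T"
  using assms orth_linear by (auto simp: pos_orth_def)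

lemma pos_orth_mono: "T \<in> pos_orth \<Longrightarrow> x \<le> y \<Longrightarrow> T x \<le> T y"
  using pos_orth_nonneg[of T "y - x"] by (simp add: linear_diff pos_orth_linear)

lemma pos_part_pos_orth: "T \<in> orth \<Longrightarrow> pos_part T \<in> pos_orth"
  by (simp add: pos_orth_def pos_part_orth pos_part_of_nonneg)

lemma pos_orth_inf_zero:
  assumes T: "T \<in> pos_orth" and xy: "inf x y = 0"
  shows "inf (T x) y = 0"
proof -
  have *: "0 \<le> x" "0 \<le> y"
    using xy by (metis inf.cobounded1 inf.cobounded2)+
  then show ?thesis
    using orth_disjoint[OF pos_orth_orth[OF T], of x y] xy pos_orth_nonneg[OF T]
    by (simp add: disjoint_iff_inf)
qed

lemma id_op_UNIV [simp]: "id_op UNIV x = x"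
  by (simp add: id_op_def)

lemma linear_eq_if_eq_nonneg:
  fixes f g :: "'a::archimedean_vector_lattice \<Rightarrow> 'b::real_vector"
  assumes f: "linear f" and g: "linear g" and eq: "\<And>x. 0 \<le> x \<Longrightarrow> f x = g x"
  shows "f = g"
proof
  fix x
  have "f (pprt x - pprt (- x)) = g (pprt x - pprt (- x))"
    unfolding linear_diff[OF f] linear_diff[OF g] by (simp add: eq)
  then show "f x = g x"
    by (simp only: pprt_diff_eq)
qed

lemma pos_part_disjoint_pos_part_minus:
  assumes T: "T \<in> orth" and x: "0 \<le> x"
  shows "inf (pos_part T x) (pos_part (- T) x) = 0"
  using pprt_disjoint[of "T x"] x by (simp add: pos_part_of_nonneg T univ.Orth_minus)

text \<open>Disjointness of two positive orthomorphisms at equal arguments extends to different arguments,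
  because both values are dominated by the values at \<open>x + y\<close>.\<close>

lemma pos_orth_inf_zero_cone:
  assumes P: "P \<in> pos_orth" and Q: "Q \<in> pos_orth" and PQ: "\<And>x. 0 \<le> x \<Longrightarrow> inf (P x) (Q x) = 0"
    and xy: "0 \<le> x" "0 \<le> y"
  shows "inf (P x) (Q y) = 0"
  using xy by (intro inf_zero_mono[OF PQ[of "x + y"]] pos_orth_mono[OF P] pos_orth_mono[OF Q])
    (auto intro: pos_orth_nonneg P Q)

text \<open>The image of \<open>pos_part T\<close> on \<open>y = pos_part (- T) x\<close> is disjoint from \<open>y\<close>; as \<open>pos_part T\<close>
  preserves disjointness, the image is disjoint from itself.\<close>

lemma pos_part_pos_part_minus_eq_zero:
  assumes T: "T \<in> orth"
  shows "pos_part T (pos_part (- T) x) = 0"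
proof -
  note pos_orth = pos_part_pos_orth[OF T] pos_part_pos_orth[OF univ.Orth_minus[OF T]]
  have "pos_part T \<circ> pos_part (- T) = (\<lambda>x. 0)"
  proof (rule linear_eq_if_eq_nonneg)
    show "linear (pos_part T \<circ> pos_part (- T))"
      using pos_orth by (intro linear_compose pos_orth_linear)
    show "linear (\<lambda>x. 0)"
      by (rule linear_zero)
    fix x :: 'a
    assume x: "0 \<le> x"
    let ?y = "pos_part (- T) x"
    have y: "0 \<le> ?y"
      using pos_orth_nonneg[OF pos_orth(2) x] .
    have "inf ?y (pos_part T ?y) = 0"
      using pos_orth_inf_zero_cone[OF pos_orth pos_part_disjoint_pos_part_minus[OF T] y x] by (simp add: inf.commute)
    then have "inf (pos_part T ?y) (pos_part T ?y) = 0"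
      by (rule pos_orth_inf_zero[OF pos_orth(1)])
    then show "(pos_part T \<circ> pos_part (- T)) x = 0"
      by simp
  qed
  then show ?thesis
    by (metis comp_apply)
qed

text \<open>The mixed terms of \<open>(A\<^sup>+ - A\<^sup>-)\<^sup>2\<close> vanish.\<close>

lemma orth_square_nonneg:
  assumes A: "A \<in> orth" and x: "0 \<le> x"
  shows "0 \<le> A (A x)"
proof -
  let ?P = "pos_part A" and ?N = "pos_part (- A)"
  have P: "?P \<in> pos_orth" and N: "?N \<in> pos_orth"
    using A by (auto intro: pos_part_pos_orth univ.Orth_minus)
  note lin = linear_diff[OF pos_orth_linear[OF P]] linear_diff[OF pos_orth_linear[OF N]]
  have eq: "A y = ?P y - ?N y" for y
    using pos_part_diff_pos_part_minus[OF A] by simp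
  have "?P (?N x) = 0" "?N (?P x) = 0"
    using pos_part_pos_part_minus_eq_zero[OF A] pos_part_pos_part_minus_eq_zero[OF univ.Orth_minus[OF A]] by simp_all
  then have "A (A x) = ?P (?P x) + ?N (?N x)"
    by (simp add: eq lin)
  then show ?thesis
    using P N x by (simp add: pos_orth_nonneg)
qed

lemma orth_diff_scaleR_id: "T \<in> orth \<Longrightarrow> T - r *\<^sub>R id_op UNIV \<in> orth"
  by (intro univ.Orth_diff univ.Orth_scaleR univ.Orth_id)

text \<open>Positivity of \<open>(T - r I)\<^sup>2\<close>.\<close>

lemma orth_amgm:
  assumes T: "T \<in> orth" and x: "0 \<le> x"
  shows "(2 * r) *\<^sub>R T x \<le> (r * r) *\<^sub>R x + T (T x)"
  using orth_square_nonneg[OF orth_diff_scaleR_id[OF T, of r] x]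
    linear_diff[OF orth_linear[OF T]] linear_scale[OF orth_linear[OF T]]
  by (simp add: scaleR_fun_def algebra_simps flip: scaleR_2)

lemma pos_orth_amgm:
  assumes T: "T \<in> pos_orth" and x: "0 \<le> x"
  shows "real n *\<^sub>R T x \<le> (real n * real n) *\<^sub>R x + T (T x)"
proof -
  have "real n *\<^sub>R T x \<le> (2 * real n) *\<^sub>R T x"
    using pos_orth_nonneg[OF T x] by (intro scaleR_right_mono) auto
  also have "\<dots> \<le> (real n * real n) *\<^sub>R x + T (T x)"
    by (rule orth_amgm[OF pos_orth_orth[OF T] x])
  finally show ?thesis .
qed

text \<open>With \<open>A = I - n D\<close>: \<open>n A\<^sup>+ D = A\<^sup>+ (I - A) = A\<^sup>+ - (A\<^sup>+)\<^sup>2 \<le> A\<^sup>+ \<le> I\<close>, where the last step holds because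
  \<open>A \<le> I\<close>.\<close>

lemma pos_part_truncation:
  assumes D: "D \<in> pos_orth" and x: "0 \<le> x"
  shows "real n *\<^sub>R pos_part (id_op UNIV - real n *\<^sub>R D) (D x) \<le> x"
proof -
  let ?A = "id_op UNIV - real n *\<^sub>R D"
  have A: "?A \<in> orth"
    using D by (intro univ.Orth_diff univ.Orth_scaleR univ.Orth_id pos_orth_orth)
  note P = pos_part_pos_orth[OF A]
  note lin = linear_diff[OF pos_orth_linear[OF P]] linear_scale[OF pos_orth_linear[OF P]]
  have "x - (pos_part ?A x - pos_part (- ?A) x) = real n *\<^sub>R D x"
    unfolding pos_part_diff_pos_part_minus[OF A] by (simp add: scaleR_fun_def)
  then have "real n *\<^sub>R pos_part ?A (D x) = pos_part ?A (x - (pos_part ?A x - pos_part (- ?A) x))"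
    by (simp only: lin(2))
  also have "\<dots> = pos_part ?A x - pos_part ?A (pos_part ?A x)"
    using pos_part_pos_part_minus_eq_zero[OF A, of x] by (simp only: lin) simp
  also have "\<dots> \<le> pos_part ?A x"
    using pos_orth_nonneg[OF P pos_orth_nonneg[OF P x]] by simp
  also have "\<dots> \<le> x"
    using x pos_orth_nonneg[OF D x] unfolding pos_part_of_nonneg[OF A x]
    by (intro pprt_least) (auto simp: scaleR_fun_def intro: scaleR_nonneg_nonneg)
  finally show ?thesis .
qed

text \<open>Least upper bounds in \<open>Orth(E)\<close> are pointwise on the positive cone: the value of this one at
  \<open>x \<ge> 0\<close> is \<open>A x \<squnion> B x\<close>.\<close>

lemma orth_lub:
  assumes A: "A \<in> orth" and B: "B \<in> orth"
  shows "is_lub_on orth (op_le UNIV (\<le>) (\<le>)) {A, B} (A + pos_part (B - A))"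
proof -
  have BA: "B - A \<in> orth"
    using A B by (rule univ.Orth_diff[rotated])
  have "pprt (B x - A x) \<le> u x - A x" if "A x \<le> u x" "B x \<le> u x" for u and x :: 'a
    using that by (intro pprt_least) auto
  moreover have "B x \<le> A x + pprt (B x - A x)" for x
    using pprt_ge[of "B x - A x"] by (simp add: algebra_simps)
  ultimately show ?thesis
    using A pos_part_orth[OF BA]
    by (auto simp: is_lub_on_def op_le_def pos_part_of_nonneg[OF BA] univ.Orth_add algebra_simps)
qed

section \<open>Orthomorphisms commute\<close>

lemma modulus_diff_le_sup:
  assumes "disjoint x y"
  shows "modulus (x - y) \<le> sup (modulus x) (modulus y)"
  using modulus_diff[of x y] add_eq_sup_if_inf_zero[of "modulus x" "modulus y"] assms
  by (simp add: disjoint_def)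

text \<open>All four values \<open>P B x\<close>, \<open>B P x\<close>, \<open>Q B x\<close>, \<open>B Q x\<close> are positive, and the first two are disjoint
  from the last two, since applying \<open>B\<close> keeps disjointness.\<close>

lemma commutators_disjoint:
  assumes P: "P \<in> pos_orth" and Q: "Q \<in> pos_orth" and B: "B \<in> pos_orth"
    and PQ: "\<And>x. 0 \<le> x \<Longrightarrow> inf (P x) (Q x) = 0" and x: "0 \<le> x"
  shows "disjoint (P (B x) - B (P x)) (Q (B x) - B (Q x))"
proof -
  note nonneg = pos_orth_nonneg[OF B] pos_orth_nonneg[OF P] pos_orth_nonneg[OF Q]
  have PQ': "inf (P a) (Q b) = 0" if "0 \<le> a" "0 \<le> b" for a b
    using pos_orth_inf_zero_cone[OF P Q PQ that] .
  have B': "inf a (B b) = 0" if "inf a b = 0" for a b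
    using pos_orth_inf_zero[OF B, of b a] that by (simp add: inf.commute)
  have l: "inf (P (B x)) (Q (B x) + B (Q x)) = 0"
    using x by (intro inf_zero_add PQ' B' nonneg)
  have r: "inf (B (P x)) (Q (B x) + B (Q x)) = 0"
    using x by (intro inf_zero_add PQ' B' nonneg pos_orth_inf_zero[OF B])
  have "inf (Q (B x) + B (Q x)) (P (B x) + B (P x)) = 0"
    using l r by (intro inf_zero_add) (simp_all add: inf.commute)
  then have "disjoint (P (B x) + B (P x)) (Q (B x) + B (Q x))"
    using x by (simp add: disjoint_iff_inf nonneg inf.commute)
  moreover have "modulus (S (B x) - B (S x)) \<le> modulus (S (B x) + B (S x))" if "S \<in> pos_orth" for S
    using modulus_diff[of "S (B x)" "B (S x)"] x by (simp add: nonneg pos_orth_nonneg[OF that])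
  ultimately show ?thesis
    using P Q disjoint_mono by blast
qed

lemma modulus_commutator_le:
  assumes "P \<in> pos_orth" "B \<in> pos_orth" "0 \<le> x"
  shows "modulus (P (B x) - B (P x)) \<le> P (B x) + B (P x)"
  using modulus_diff[of "P (B x)" "B (P x)"] assms by (simp add: pos_orth_nonneg)

text \<open>Let \<open>R\<close> and \<open>N\<close> be the positive and negative part of \<open>A - e I\<close>. The commutator of \<open>A\<close> with
  \<open>B\<close> is the difference of those of \<open>R\<close> and \<open>N\<close>, which are disjoint, and \<open>0 \<le> N \<le> e I\<close> bounds the
  second one by \<open>2 e B x\<close>. Disjointness turns the sum of the two bounds into a supremum, and this is
  what allows the estimate to be iterated without accumulating errors.\<close>

lemma commutator_le_truncation:
  assumes A: "A \<in> pos_orth" and B: "B \<in> pos_orth" and e: "0 \<le> e" and x: "0 \<le> x"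
  defines "R \<equiv> pos_part (A - e *\<^sub>R id_op UNIV)"
  shows "modulus (A (B x) - B (A x)) \<le> sup ((2 * e) *\<^sub>R B x) (modulus (R (B x) - B (R x)))"
proof -
  let ?C = "A - e *\<^sub>R id_op UNIV"
  let ?N = "pos_part (- ?C)"
  have C: "?C \<in> orth"
    using A by (intro orth_diff_scaleR_id pos_orth_orth)
  have R: "R \<in> pos_orth" and N: "?N \<in> pos_orth"
    unfolding R_def by (intro pos_part_pos_orth univ.Orth_minus C)+
  have A_eq: "A y = e *\<^sub>R y + (R y - ?N y)" for y
    using pos_part_diff_pos_part_minus[OF C, of y] by (simp add: R_def scaleR_fun_def)
  have N_le: "?N y \<le> e *\<^sub>R y" if "0 \<le> y" for y
    unfolding pos_part_of_nonneg[OF univ.Orth_minus[OF C] that]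
    using pos_orth_nonneg[OF A that] that e
    by (intro pprt_least scaleR_nonneg_nonneg) (auto simp: scaleR_fun_def)
  have eq: "A (B x) - B (A x) = (R (B x) - B (R x)) - (?N (B x) - B (?N x))"
    using linear_add[OF pos_orth_linear[OF B]] linear_diff[OF pos_orth_linear[OF B]]
      linear_scale[OF pos_orth_linear[OF B]]
    by (simp only: A_eq) (simp add: algebra_simps)
  have 1: "modulus (A (B x) - B (A x)) \<le>
    sup (modulus (R (B x) - B (R x))) (modulus (?N (B x) - B (?N x)))"
    unfolding eq unfolding R_def
    by (intro modulus_diff_le_sup commutators_disjoint R[unfolded R_def] N B x pos_part_disjoint_pos_part_minus C)
  have 2: "modulus (?N (B x) - B (?N x)) \<le> (2 * e) *\<^sub>R B x"
  proof -
    have "modulus (?N (B x) - B (?N x)) \<le> ?N (B x) + B (?N x)"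
      by (rule modulus_commutator_le[OF N B x])
    also have "\<dots> \<le> e *\<^sub>R B x + B (e *\<^sub>R x)"
      by (rule add_mono[OF N_le[OF pos_orth_nonneg[OF B x]] pos_orth_mono[OF B N_le[OF x]]])
    also have "\<dots> = (2 * e) *\<^sub>R B x"
      unfolding linear_scale[OF pos_orth_linear[OF B]] mult_2 scaleR_add_left ..
    finally show ?thesis .
  qed
  show ?thesis
    using order.trans[OF 1 sup.mono[OF order.refl 2]] by (simp add: sup.commute)
qed

lemma pos_part_pos_part_truncation:
  assumes A: "A \<in> orth" and e: "0 \<le> e"
  shows "pos_part (pos_part A - e *\<^sub>R id_op UNIV) = pos_part (A - e *\<^sub>R id_op UNIV)"
proof (rule linear_eq_if_eq_nonneg)
  show "linear (pos_part (pos_part A - e *\<^sub>R id_op UNIV))" "linear (pos_part (A - e *\<^sub>R id_op UNIV))"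
    using A by (auto intro: pos_part_linear orth_diff_scaleR_id pos_part_orth)
  fix x :: 'a
  assume x: "0 \<le> x"
  have "0 \<le> e *\<^sub>R x"
    using e x by (rule scaleR_nonneg_nonneg)
  then have "sup (sup (A x) 0 - e *\<^sub>R x) 0 = sup (A x - e *\<^sub>R x) 0"
    using add_sup_distrib_right[of "A x" 0 "- (e *\<^sub>R x)"] by (simp add: sup.assoc sup_absorb2)
  then show "pos_part (pos_part A - e *\<^sub>R id_op UNIV) x = pos_part (A - e *\<^sub>R id_op UNIV) x"
    unfolding pos_part_of_nonneg[OF orth_diff_scaleR_id[OF pos_part_orth[OF A]] x]
      pos_part_of_nonneg[OF orth_diff_scaleR_id[OF A] x]
    by (simp add: pos_part_of_nonneg[OF A x] scaleR_fun_def pprt_def)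
qed

lemma commutator_le_truncation_multiple:
  assumes A: "A \<in> pos_orth" and B: "B \<in> pos_orth" and e: "0 \<le> e" and x: "0 \<le> x"
  defines "R \<equiv> \<lambda>m::nat. pos_part (A - (real m * e) *\<^sub>R id_op UNIV)"
  shows "modulus (A (B x) - B (A x)) \<le> sup ((2 * e) *\<^sub>R B x) (modulus (R m (B x) - B (R m x)))"
proof (induction m)
  case 0
  have "R 0 = A"
    unfolding R_def using A
    by (intro linear_eq_if_eq_nonneg) (auto intro: pos_part_linear pos_orth_linear pos_orth_orth
      simp: pos_part_of_nonneg pos_orth_orth pos_orth_nonneg)
  then show ?case
    by simp
next
  case (Suc m)
  have "pos_part (R m - e *\<^sub>R id_op UNIV) = pos_part (A - (real m * e) *\<^sub>R id_op UNIV - e *\<^sub>R id_op UNIV)"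
    unfolding R_def using A e by (intro pos_part_pos_part_truncation orth_diff_scaleR_id pos_orth_orth)
  also have "\<dots> = R (Suc m)"
    unfolding R_def by (rule arg_cong[of _ _ pos_part]) (simp add: algebra_simps)
  finally have R: "pos_part (R m - e *\<^sub>R id_op UNIV) = R (Suc m)" .
  have "R m \<in> pos_orth"
    unfolding R_def using A by (intro pos_part_pos_orth orth_diff_scaleR_id pos_orth_orth)
  from commutator_le_truncation[OF this B e x] show ?case
    unfolding R using Suc.IH by (meson order.trans sup.boundedI sup.cobounded1)
qed

text \<open>Iterate the truncation \<open>n\<^sup>2\<close> times with \<open>e = 1 / n\<close>: what remains of \<open>A\<close> is \<open>(A - n I)\<^sup>+\<close>, which is at
  most \<open>A\<^sup>2 / n\<close>. So the commutator is bounded by \<open>1 / n\<close> times an element independent of \<open>n\<close>.\<close>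

lemma pos_orth_commute:
  assumes A: "A \<in> pos_orth" and B: "B \<in> pos_orth" and x: "0 \<le> x"
  shows "A (B x) = B (A x)"
proof -
  let ?y = "2 *\<^sub>R B x + (A (A (B x)) + B (A (A x)))"
  note nonneg = pos_orth_nonneg[OF A] pos_orth_nonneg[OF B]
  have "modulus (A (B x) - B (A x)) \<le> (1 / real n) *\<^sub>R ?y" if n: "0 < n" for n :: nat
  proof -
    let ?R = "pos_part (A - real n *\<^sub>R id_op UNIV)"
    have C: "A - real n *\<^sub>R id_op UNIV \<in> orth"
      using A by (intro orth_diff_scaleR_id pos_orth_orth)
    have R: "?R z \<le> (1 / real n) *\<^sub>R A (A z)" if z: "0 \<le> z" for z
      unfolding pos_part_of_nonneg[OF C z]
    proof (rule pprt_least)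
      have "(1 / real n) *\<^sub>R (real n *\<^sub>R (A z - real n *\<^sub>R z)) \<le> (1 / real n) *\<^sub>R A (A z)"
        using pos_orth_amgm[OF A z, of n] by (intro scaleR_left_mono) (simp_all add: scaleR_diff_right diff_le_eq add.commute)
      then show "(A - real n *\<^sub>R id_op UNIV) z \<le> (1 / real n) *\<^sub>R A (A z)"
        using n by (simp add: scaleR_fun_def)
      show "0 \<le> (1 / real n) *\<^sub>R A (A z)"
        using z by (intro scaleR_nonneg_nonneg nonneg) auto
    qed
    have "modulus (A (B x) - B (A x)) \<le>
        sup ((2 * (1 / real n)) *\<^sub>R B x) (modulus (?R (B x) - B (?R x)))"
      using commutator_le_truncation_multiple[OF A B _ x, of "1 / real n" "n * n"] n by simp
    also have "\<dots> \<le> (2 * (1 / real n)) *\<^sub>R B x + (?R (B x) + B (?R x))"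
    proof (rule sup_least)
      have "0 \<le> ?R (B x) + B (?R x)"
        by (intro add_nonneg_nonneg nonneg(2) pos_orth_nonneg[OF pos_part_pos_orth[OF C]] x)
      then show "(2 * (1 / real n)) *\<^sub>R B x \<le> (2 * (1 / real n)) *\<^sub>R B x + (?R (B x) + B (?R x))"
        by simp
      have "0 \<le> (2 * (1 / real n)) *\<^sub>R B x"
        using nonneg(2)[OF x] by (intro scaleR_nonneg_nonneg) auto
      then show "modulus (?R (B x) - B (?R x)) \<le> (2 * (1 / real n)) *\<^sub>R B x + (?R (B x) + B (?R x))"
        using modulus_commutator_le[OF pos_part_pos_orth[OF C] B x] by (rule add_increasing)
    qed
    also have "\<dots> \<le> (2 * (1 / real n)) *\<^sub>R B x +
        ((1 / real n) *\<^sub>R A (A (B x)) + B ((1 / real n) *\<^sub>R A (A x)))"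
      by (intro add_left_mono add_mono R[OF nonneg(2)[OF x]] pos_orth_mono[OF B R[OF x]])
    also have "\<dots> = (1 / real n) *\<^sub>R ?y"
      by (simp add: linear_scale[OF pos_orth_linear[OF B]] algebra_simps)
    finally show ?thesis .
  qed
  from eq_zero_if_le_scaleR[OF modulus_nonneg this] have "modulus (A (B x) - B (A x)) = 0"
    by blast
  then show ?thesis
    using disjoint_self[of "A (B x) - B (A x)"] by (simp add: disjoint_def)
qed

lemma orth_commute:
  assumes A: "A \<in> orth" and B: "B \<in> orth"
  shows "A \<circ> B = B \<circ> A"
proof (rule linear_eq_if_eq_nonneg)
  show "linear (A \<circ> B)" "linear (B \<circ> A)"
    using A B by (auto intro: linear_compose orth_linear)
  fix x :: 'a
  assume x: "0 \<le> x"
  have eq: "S y = pos_part S y - pos_part (- S) y" if "S \<in> orth" for S and y :: 'a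
    using pos_part_diff_pos_part_minus[OF that] by simp
  have p: "pos_part S \<in> pos_orth" "pos_part (- S) \<in> pos_orth" if "S \<in> orth" for S :: "'a \<Rightarrow> 'a"
    using that by (auto intro: pos_part_pos_orth univ.Orth_minus)
  note lin = p[THEN pos_orth_linear, THEN linear_diff]
  show "(A \<circ> B) x = (B \<circ> A) x"
    using pos_orth_commute[OF _ _ x] p[OF A] p[OF B]
    by (simp add: eq[OF A] eq[OF B] lin[OF A] lin[OF B])
qed

section \<open>Positive representations of the orthomorphisms\<close>

text \<open>This captures what \<open>rho X\<close> and \<open>lam X\<close> have in common. Of a single operator \<open>h T\<close> it
  assumes linearity and, for \<open>T \<ge> 0\<close>, positivity; that \<open>h T\<close> is an orthomorphism is a consequence.\<close>

locale orth_representation = archimedean_vector_lattice_on G le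
  for G :: "'v::real_vector set" and le :: "'v \<Rightarrow> 'v \<Rightarrow> bool" +
  fixes h :: "('a::archimedean_vector_lattice \<Rightarrow> 'a) \<Rightarrow> 'v \<Rightarrow> 'v"
  assumes ppp: "principal_projection_property G le"
    and outside: "x \<notin> G \<Longrightarrow> h T x = 0"
    and linear_map: "T \<in> orth \<Longrightarrow> linear_map_on G G (h T)"
    and h_add: "A \<in> orth \<Longrightarrow> B \<in> orth \<Longrightarrow> h (A + B) = h A + h B"
    and h_scaleR: "A \<in> orth \<Longrightarrow> h (r *\<^sub>R A) = r *\<^sub>R h A"
    and h_comp: "A \<in> orth \<Longrightarrow> B \<in> orth \<Longrightarrow> h (A \<circ> B) = h A \<circ> h B"
    and h_id: "h (id_op UNIV) = id_op G"
    and h_nonneg: "T \<in> pos_orth \<Longrightarrow> x \<in> G \<Longrightarrow> le 0 x \<Longrightarrow> le 0 (h T x)"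
begin

lemma h_mem: "T \<in> orth \<Longrightarrow> x \<in> G \<Longrightarrow> h T x \<in> G"
  using linear_map[of T] by (simp add: linear_map_on_def)

lemma h_diff: "A \<in> orth \<Longrightarrow> B \<in> orth \<Longrightarrow> h (A - B) = h A - h B"
  using h_add[of A "- B"] h_scaleR[of B "-1"] univ.Orth_minus[of B] by simp

lemma h_mono:
  assumes "A \<in> orth" "B \<in> orth" "\<And>y. 0 \<le> y \<Longrightarrow> A y \<le> B y" "x \<in> G" "le 0 x"
  shows "le (h A x) (h B x)"
  using h_nonneg[of "B - A" x] assms
  by (simp add: le_iff_diff_nonneg[OF h_mem h_mem] h_diff univ.Orth_diff pos_orth_def)

lemma h_pos_mono:
  assumes T: "T \<in> pos_orth" and xy: "x \<in> G" "y \<in> G" "le x y"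
  shows "le (h T x) (h T y)"
  using h_nonneg[OF T, of "y - x"] xy linear_map_on_diff[OF linear_map[OF pos_orth_orth[OF T]], of y x]
  by (simp add: le_iff_diff_nonneg[of x y] le_iff_diff_nonneg[of "h T x" "h T y"]
    h_mem[OF pos_orth_orth[OF T]])

lemma h_zero: "T \<in> orth \<Longrightarrow> h T 0 = 0"
  using linear_map_on_diff[OF linear_map, of T 0 0] by simp

lemma eq_zero_if_scaleR_le:
  assumes "x \<in> G" "y \<in> G" "le 0 x" and le: "\<And>n::nat. 0 < n \<Longrightarrow> le (real n *\<^sub>R x) y"
  shows "x = 0"
proof (rule archimedean[OF assms(1-3)])
  show "le (real n *\<^sub>R x) y" for n
    using le[of n] le[of 1] trans[of 0 x y] assms by (cases "n = 0") auto
qed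

text \<open>The component \<open>v\<close> of \<open>h T p\<close> that is disjoint from \<open>p\<close> satisfies
  \<open>n v - h (T\<^sup>2) p \<le> n\<^sup>2 p\<close> and trivially \<open>n v - h (T\<^sup>2) p \<le> n\<^sup>2 v\<close>. Disjointness then gives
  \<open>n v - h (T\<^sup>2) p \<le> 0\<close>.\<close>

lemma h_mem_principal_band:
  assumes T: "T \<in> pos_orth" and p: "p \<in> G" "le 0 p"
  shows "h T p \<in> principal_band G le p"
proof -
  let ?B = "principal_band G le p"
  have Torth: "T \<in> orth" and TT: "T \<circ> T \<in> orth"
    using T pos_orth_orth univ.Orth_comp by blast+
  have p_B: "p \<in> ?B"
    by (auto simp: principal_band_def)
  have "projection_band G le ?B"
    using ppp p by (simp add: principal_projection_property_def)
  then obtain u v where u: "u \<in> ?B" and v: "v \<in> disjoint_complement G le ?B" and uv: "h T p = u + v"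
    and B: "band G le ?B"
    using h_mem[OF Torth p(1)] unfolding projection_band_def by blast
  have G: "u \<in> G" "v \<in> G" "h T p \<in> G" "h (T \<circ> T) p \<in> G"
    using u v band_subset[OF B] h_mem Torth TT p by (auto simp: disjoint_complement_def)
  have disj: "le w 0" if "w \<in> G" "b \<in> ?B" "le w (vl_abs G le v)" "le w (vl_abs G le b)" for w b
    using v that unfolding disjoint_complement_def vl_disjoint_def is_glb_on_def by auto
  have hT: "le 0 (h T p)"
    by (rule h_nonneg[OF T p])
  \<comment> \<open>As \<open>u + v \<ge> 0\<close>, the element \<open>- v\<close> is below both \<open>|u|\<close> and \<open>|v|\<close>, and so is \<open>- u\<close>.\<close>
  have v0: "le 0 v"
  proof -
    have "le (- v) u"
      using hT uv G le_iff_diff_nonneg[of "- v" u] by simp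
    then have "le (- v) 0"
      using G u by (intro disj[of "- v" u]) (auto intro: vl_abs_ge_minus trans[OF _ _ _ _ vl_abs_ge])
    then show ?thesis
      using minus_mono[of "- v" 0] G by simp
  qed
  have u0: "le 0 u"
  proof -
    have "le (- u) v"
      using hT uv G le_iff_diff_nonneg[of "- u" v] by (simp add: add.commute)
    then have "le (- u) 0"
      using G u by (intro disj[of "- u" u]) (auto intro: vl_abs_ge_minus trans[OF _ _ _ _ vl_abs_ge])
    then show ?thesis
      using minus_mono[of "- u" 0] G by simp
  qed
  have "le (real n *\<^sub>R v) (h (T \<circ> T) p)" if n: "0 < n" for n :: nat
  proof -
    let ?k = "h (T \<circ> T) p"
    let ?z = "real n *\<^sub>R v - ?k" and ?c = "1 / (real n * real n)"
    have k0: "le 0 ?k"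
      using T pos_orth_nonneg TT by (intro h_nonneg p) (auto simp: pos_orth_def)
    have nT: "real n *\<^sub>R T \<in> orth" and nI: "(real n * real n) *\<^sub>R id_op UNIV + (T \<circ> T) \<in> orth"
      by (intro univ.Orth_scaleR univ.Orth_add univ.Orth_id Torth TT)+
    have "le (h (real n *\<^sub>R T) p) (h ((real n * real n) *\<^sub>R id_op UNIV + (T \<circ> T)) p)"
      using pos_orth_amgm[OF T] by (intro h_mono nT nI p) (simp add: scaleR_fun_def)
    then have "le (real n *\<^sub>R h T p) ((real n * real n) *\<^sub>R p + ?k)"
      unfolding h_scaleR[OF Torth] h_add[OF univ.Orth_scaleR[OF univ.Orth_id] TT]
        h_scaleR[OF univ.Orth_id] h_id
      using p by (simp add: scaleR_fun_def id_op_def)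
    moreover have "le v (h T p)"
      using u0 G uv le_iff_diff_nonneg[of v "h T p"] by simp
    then have "le (real n *\<^sub>R v) (real n *\<^sub>R h T p)"
      using G by (intro scaleR_mono) auto
    ultimately have "le (real n *\<^sub>R v) ((real n * real n) *\<^sub>R p + ?k)"
      using trans[of "real n *\<^sub>R v" "real n *\<^sub>R h T p"] G p by simp
    then have zp: "le ?z ((real n * real n) *\<^sub>R p)"
      using G p le_iff_diff_nonneg[of "real n *\<^sub>R v" "(real n * real n) *\<^sub>R p + ?k"]
        le_iff_diff_nonneg[of ?z "(real n * real n) *\<^sub>R p"] by (simp add: algebra_simps)
    have "le 0 ((real n * real n - real n) *\<^sub>R v)"
      using scaleR_mono[of 0 v "real n * real n - real n"] v0 G n by (simp add: algebra_simps)
    then have "le 0 ((real n * real n - real n) *\<^sub>R v + ?k)"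
      using add_mono[of 0 _ 0 ?k] k0 G by simp
    then have zv: "le ?z ((real n * real n) *\<^sub>R v)"
      using G le_iff_diff_nonneg[of ?z "(real n * real n) *\<^sub>R v"] by (simp add: algebra_simps)
    have "le (?c *\<^sub>R ?z) (vl_abs G le b)" if "b \<in> G" "le 0 b" "le ?z ((real n * real n) *\<^sub>R b)" for b
      using scaleR_mono[of ?z "(real n * real n) *\<^sub>R b" ?c] that n G vl_abs_of_nonneg[of b] by simp
    then have "le (?c *\<^sub>R ?z) 0"
      using G p zp zv v0 p_B by (intro disj[of _ p]) auto
    then have "le ?z 0"
      using scaleR_mono[of "?c *\<^sub>R ?z" 0 "real n * real n"] G n by simp
    then show ?thesis
      using G le_iff_diff_nonneg[of ?z 0] le_iff_diff_nonneg[of "real n *\<^sub>R v" ?k] by simp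
  qed
  from eq_zero_if_scaleR_le[OF G(2,4) v0 this] show ?thesis
    using u uv by simp
qed

lemma h_pos_orth_mem_Orth:
  assumes T: "T \<in> pos_orth"
  shows "h T \<in> Orth G le"
proof (rule OrthI_nonneg[OF outside linear_map[OF pos_orth_orth[OF T]] h_nonneg[OF T]])
  fix B x
  assume B: "band G le B" and x: "x \<in> B"
  let ?p = "vl_abs G le x"
  have xG: "x \<in> G"
    using x band_subset[OF B] by blast
  have p: "?p \<in> G" "le 0 ?p" "?p \<in> B"
    using xG vl_abs_nonneg vl_abs_mem_band[OF B x] by auto
  have hG: "h T y \<in> G" if "y \<in> G" for y
    using that h_mem[OF pos_orth_orth[OF T]] by blast
  have "h T ?p \<in> B"
    using h_mem_principal_band[OF T p(1,2)] B p(3) by (auto simp: principal_band_def)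
  moreover have "le (h T x) (h T ?p)"
    by (intro h_pos_mono[OF T] xG p vl_abs_ge)
  moreover have "le (h T (0 - x)) (h T ?p)"
    using vl_abs_ge_minus[OF xG] by (intro h_pos_mono[OF T] p) (use xG in auto)
  then have "le (- h T x) (h T ?p)"
    using linear_map_on_diff[OF linear_map[OF pos_orth_orth[OF T]], of 0 x] h_zero[OF pos_orth_orth[OF T]] xG
    by simp
  ultimately show "h T x \<in> B"
    using band_ideal[OF B hG[OF xG], of "h T ?p"] vl_abs_least[OF hG[OF xG] hG[OF p(1)]]
      vl_abs_of_nonneg[OF hG[OF p(1)] h_nonneg[OF T p(1,2)]] by simp
qed

lemma h_mem_Orth:
  assumes T: "T \<in> orth"
  shows "h T \<in> Orth G le"
proof -
  have P: "pos_part T \<in> pos_orth" "pos_part (- T) \<in> pos_orth"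
    using T by (auto intro: pos_part_pos_orth univ.Orth_minus)
  have "pos_part T - pos_part (- T) = T"
    using pos_part_diff_pos_part_minus[OF T] by (simp add: fun_eq_iff)
  then have "h T = h (pos_part T) - h (pos_part (- T))"
    using h_diff[OF P[THEN pos_orth_orth]] by simp
  then show ?thesis
    using P by (simp add: h_pos_orth_mem_Orth Orth_diff)
qed

text \<open>Since \<open>h (C\<^sup>+) w \<le> h (C\<^sup>+ C\<^sup>-) x = 0\<close>, the operator \<open>h (I - n C\<^sup>+)\<close> fixes \<open>w\<close>, and therefore
  \<open>w \<le> h ((I - n C\<^sup>+)\<^sup>+) w \<le> h ((I - n C\<^sup>+)\<^sup>+ C\<^sup>+) x\<close>, where
  \<open>n (I - n C\<^sup>+)\<^sup>+ C\<^sup>+ \<le> I\<close>.\<close>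

lemma h_pos_part_disjoint:
  assumes C: "C \<in> orth" and x: "x \<in> G" "le 0 x" and w: "w \<in> G" "le 0 w"
    and le: "le w (h (pos_part C) x)" "le w (h (pos_part (- C)) x)"
  shows "w = 0"
proof (rule eq_zero_if_scaleR_le[OF w(1) x(1) w(2)])
  fix n :: nat
  let ?D = "pos_part C" and ?N = "pos_part (- C)"
  let ?A = "id_op UNIV - real n *\<^sub>R ?D"
  let ?P = "pos_part ?A"
  have D: "?D \<in> pos_orth" "?D \<in> orth" and N: "?N \<in> orth"
    using C by (auto intro: pos_part_pos_orth pos_part_orth univ.Orth_minus)
  have A: "?A \<in> orth"
    using D by (intro univ.Orth_diff univ.Orth_scaleR univ.Orth_id)
  then have P: "?P \<in> pos_orth" "?P \<in> orth"
    by (auto intro: pos_part_pos_orth pos_part_orth)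
  have PD: "?P \<circ> ?D \<in> orth"
    using P D by (intro univ.Orth_comp)
  have "?D \<circ> ?N = 0 *\<^sub>R id_op UNIV"
    using pos_part_pos_part_minus_eq_zero[OF C] by (simp add: fun_eq_iff)
  then have "h ?D (h ?N x) = h (0 *\<^sub>R id_op UNIV) x"
    using h_comp[OF D(2) N] by (metis comp_apply)
  then have "h ?D (h ?N x) = 0"
    by (simp only: h_scaleR[OF univ.Orth_id]) simp
  then have hDw: "h ?D w = 0"
    using h_pos_mono[OF D(1) w(1) _ le(2)] h_nonneg[OF D(1) w] antisym[of "h ?D w" 0]
      h_mem[OF N x(1)] h_mem[OF D(2) w(1)] by simp
  have "h ?A w = w"
    using h_diff[OF univ.Orth_id univ.Orth_scaleR[OF D(2)]] h_scaleR[OF D(2)] hDw w(1)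
    by (simp add: h_id id_op_def scaleR_fun_def)
  moreover have "le (h ?A w) (h ?P w)"
    using pprt_ge by (intro h_mono A P w) (simp add: pos_part_of_nonneg[OF A])
  moreover have "le (h ?P w) (h ?P (h ?D x))"
    by (intro h_pos_mono P w le h_mem D x)
  ultimately have "le w (h (?P \<circ> ?D) x)"
    using trans[of w "h ?P w"] h_mem[OF P(2)] h_mem[OF D(2)] w x by (simp add: h_comp[OF P(2) D(2)])
  then have "le (real n *\<^sub>R w) (h (real n *\<^sub>R (?P \<circ> ?D)) x)"
    using scaleR_mono[of w "h (?P \<circ> ?D) x" "real n"] w h_mem[OF PD x(1)]
    unfolding h_scaleR[OF PD] by (simp add: scaleR_fun_def[of _ "h _"])
  moreover have "le (h (real n *\<^sub>R (?P \<circ> ?D)) x) (h (id_op UNIV) x)"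
    using pos_part_truncation[OF D(1), of _ n]
    by (intro h_mono univ.Orth_scaleR PD univ.Orth_id x) (simp add: scaleR_fun_def)
  ultimately show "le (real n *\<^sub>R w) x"
    using trans[of "real n *\<^sub>R w" "h (real n *\<^sub>R (?P \<circ> ?D)) x" x] w x
      h_mem[OF univ.Orth_scaleR[OF PD]] by (simp add: h_id id_op_def)
qed

text \<open>Let \<open>U\<close> be another upper bound, \<open>S\<close> the supremum of \<open>A\<close> and \<open>B\<close>, and \<open>x \<ge> 0\<close>. Then
  \<open>(h S x - U x)\<^sup>+\<close>, written as \<open>h S x - m\<close> with \<open>m\<close> the infimum of \<open>h S x\<close> and \<open>U x\<close>, is below both
  \<open>h (S - A) x\<close> and \<open>h (S - B) x\<close>; as \<open>S - A\<close> and \<open>S - B\<close> are the positive and the negative part of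
  \<open>B - A\<close>, it is \<open>0\<close>.\<close>

lemma h_lub:
  assumes A: "A \<in> orth" and B: "B \<in> orth"
  shows "is_lub_on (Orth G le) (op_le G le le) {h A, h B} (h (A + pos_part (B - A)))"
proof -
  let ?C = "B - A"
  let ?S = "A + pos_part ?C"
  have C: "?C \<in> orth" "pos_part ?C \<in> orth" "pos_part (- ?C) \<in> orth"
    using A B by (auto intro: univ.Orth_diff pos_part_orth simp del: minus_diff_eq intro!: univ.Orth_minus)
  have S: "?S \<in> orth"
    using A C by (intro univ.Orth_add)
  have SB: "?S - B = pos_part (- ?C)"
    using pos_part_diff_pos_part_minus[OF C(1)] by (simp add: fun_eq_iff algebra_simps)
  have AS: "op_le UNIV (\<le>) (\<le>) A ?S" and BS: "op_le UNIV (\<le>) (\<le>) B ?S"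
    using orth_lub[OF A B] by (auto simp: is_lub_on_def)
  have "le (h ?S x) (U x)"
    if U: "U \<in> Orth G le" and x: "x \<in> G" "le 0 x" and AU: "le (h A x) (U x)" and BU: "le (h B x) (U x)"
    for U x
  proof -
    have G: "h ?S x \<in> G" "h A x \<in> G" "h B x \<in> G" "U x \<in> G"
      using h_mem S A B Orth_mem[OF U] x by auto
    obtain m where m: "is_glb_on G le {h ?S x, U x} m"
      using glb_exists G by blast
    then have mG: "m \<in> G" and mS: "le m (h ?S x)" and mU: "le m (U x)"
      by (auto simp: is_glb_on_def)
    have hm: "le (h A x) m" "le (h B x) m"
      using m AU BU G h_mono[OF A S _ x] h_mono[OF B S _ x] AS BS
      by (auto simp: is_glb_on_def op_le_def)
    have "h ?S x - m = 0"
    proof (rule h_pos_part_disjoint[OF C(1) x])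
      show "le (h ?S x - m) (h (pos_part ?C) x)"
        using diff_mono[OF G(1,1,2) mG refl hm(1)] G h_add[OF A C(2)] by simp
      show "le (h ?S x - m) (h (pos_part (- ?C)) x)"
        using diff_mono[OF G(1,1,3) mG refl hm(2)] G h_diff[OF S B] unfolding SB by simp
      show "h ?S x - m \<in> G" "le 0 (h ?S x - m)"
        using G(1) mG mS le_iff_diff_nonneg[OF mG G(1)] by simp_all
    qed
    then show ?thesis
      using mU by simp
  qed
  then show ?thesis
    using h_mem_Orth[OF S] h_mono[OF A S] h_mono[OF B S] AS BS
    by (auto simp: is_lub_on_def op_le_def)
qed

lemma Orth_hom_h: "Orth_hom UNIV (\<le>) G le h"
proof -
  have lub: "\<exists>S\<in>orth. is_lub_on orth (op_le UNIV (\<le>) (\<le>)) {A, B} S \<and>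
      is_lub_on (Orth G le) (op_le G le le) {h A, h B} (h S)" if "A \<in> orth" "B \<in> orth" for A B
    using orth_lub[OF that] h_lub[OF that] by (auto simp: is_lub_on_def)
  have "\<exists>S. is_glb_on orth (op_le UNIV (\<le>) (\<le>)) {A, B} S \<and>
      is_glb_on (Orth G le) (op_le G le le) {h A, h B} (h S)" if A: "A \<in> orth" and B: "B \<in> orth" for A B
  proof -
    have minus: "h (- T) = - h T" if "T \<in> orth" for T
      using h_scaleR[OF that, of "-1"] by simp
    obtain S where S: "S \<in> orth" "is_lub_on orth (op_le UNIV (\<le>) (\<le>)) {- A, - B} S"
      "is_lub_on (Orth G le) (op_le G le le) {h (- A), h (- B)} (h S)"
      using lub[OF A[THEN univ.Orth_minus] B[THEN univ.Orth_minus]] by blast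
    show ?thesis
      by (rule exI[of _ "- S"])
        (use S A B in \<open>simp add: univ.Orth_glb_iff_lub_minus Orth_glb_iff_lub_minus univ.Orth_minus
          h_mem_Orth minus Orth_minus\<close>)
  qed
  moreover have "\<exists>S. is_lub_on orth (op_le UNIV (\<le>) (\<le>)) {A, B} S \<and>
      is_lub_on (Orth G le) (op_le G le le) {h A, h B} (h S)" if "A \<in> orth" "B \<in> orth" for A B
    using lub[OF that] by blast
  ultimately show ?thesis
    unfolding Orth_hom_def unital_vla_hom_def linear_map_on_def
    using h_mem_Orth h_add h_scaleR h_comp h_id by auto
qed

end

section \<open>Composition with orthomorphisms\<close>

lemma sublattice_linear:
  assumes "vector_sublattice L_ob L_le X" "S \<in> X"
  shows "linear S"
  using assms by (auto simp: vector_sublattice_def ob_ops_def linear_map_on_def intro!: linearI)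

lemma archimedean_vector_lattice_on_sublattice:
  fixes X :: "('e::archimedean_vector_lattice \<Rightarrow> 'f::archimedean_vector_lattice) set"
  assumes X: "vector_sublattice L_ob L_le X"
  shows "archimedean_vector_lattice_on X L_le"
proof
  have L_ob: "X \<subseteq> L_ob"
    using X by (simp add: vector_sublattice_def)
  note lin = sublattice_linear[OF X]
  show "subspace X"
    using X by (simp add: vector_sublattice_def)
  show "S = T" if "S \<in> X" "T \<in> X" "L_le S T" "L_le T S" for S T
    using that by (intro linear_eq_if_eq_nonneg lin) (auto simp: op_le_def intro: order.antisym)
  show "\<exists>s. is_lub_on X L_le {S, T} s" if "S \<in> X" "T \<in> X" for S T
  proof -
    have "\<exists>s\<in>X. is_lub_on L_ob L_le {S, T} s"
      using X that by (simp add: vector_sublattice_def)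
    then obtain s where "s \<in> X" "is_lub_on L_ob L_le {S, T} s" ..
    then show ?thesis
      using L_ob unfolding is_lub_on_def by blast
  qed
  show "S = 0" if S: "S \<in> X" and T: "T \<in> X" and pos: "L_le 0 S" and le: "\<And>n. L_le (real n *\<^sub>R S) T" for S T
  proof (rule linear_eq_if_eq_nonneg[OF lin[OF S]])
    show "linear (0 :: 'e \<Rightarrow> 'f)"
      by (simp add: zero_fun_def linear_zero)
    show "S x = 0 x" if "0 \<le> x" for x
      using archimedean[of "S x" "T x"] pos le that by (simp add: op_le_def scaleR_fun_def)
  qed
qed (auto simp: op_le_def scaleR_fun_def intro: order.trans scaleR_left_mono)

text \<open>The order of the factors is reversed by \<open>rho X\<close>, so that multiplicativity rests on
  \<open>orth_commute\<close>.\<close>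

lemma orth_representation_rho:
  fixes X :: "('e::archimedean_vector_lattice \<Rightarrow> 'f::archimedean_vector_lattice) set"
  assumes X: "vector_sublattice L_ob L_le X" and ppp: "principal_projection_property X L_le"
    and comp: "\<And>S T. S \<in> X \<Longrightarrow> T \<in> orth \<Longrightarrow> S \<circ> T \<in> X"
  shows "orth_representation X L_le (rho X)"
proof -
  interpret archimedean_vector_lattice_on X L_le
    by (rule archimedean_vector_lattice_on_sublattice[OF X])
  note lin = sublattice_linear[OF X]
  show ?thesis
  proof
    show "linear_map_on X X (rho X T)" if "T \<in> orth" for T
      using comp that scaleR_mem[unfolded scaleR_fun_def]
      by (auto simp: linear_map_on_def rho_def fun_eq_iff scaleR_fun_def)
    show "rho X (A + B) = rho X A + rho X B" if "A \<in> orth" "B \<in> orth" for A B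
      by (auto simp: rho_def fun_eq_iff linear_add[OF lin])
    show "rho X (r *\<^sub>R A) = r *\<^sub>R rho X A" if "A \<in> orth" for r A
      by (auto simp: rho_def fun_eq_iff scaleR_fun_def linear_scale[OF lin])
    show "rho X (A \<circ> B) = rho X A \<circ> rho X B" if "A \<in> orth" "B \<in> orth" for A B
      unfolding orth_commute[OF that] using comp[OF _ that(2)] by (auto simp: rho_def fun_eq_iff)
    show "rho X (id_op UNIV) = id_op X"
      by (auto simp: rho_def id_op_def fun_eq_iff)
    show "L_le 0 (rho X T S)" if "T \<in> pos_orth" "S \<in> X" "L_le 0 S" for T S
      using that pos_orth_nonneg[OF that(1)] by (auto simp: op_le_def rho_def)
  qed (use ppp in \<open>auto simp: rho_def\<close>)
qed

lemma orth_representation_lam: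
  fixes X :: "('e::archimedean_vector_lattice \<Rightarrow> 'f::archimedean_vector_lattice) set"
  assumes X: "vector_sublattice L_ob L_le X" and ppp: "principal_projection_property X L_le"
    and comp: "\<And>S T. S \<in> X \<Longrightarrow> T \<in> orth \<Longrightarrow> T \<circ> S \<in> X"
  shows "orth_representation X L_le (lam X)"
proof -
  interpret archimedean_vector_lattice_on X L_le
    by (rule archimedean_vector_lattice_on_sublattice[OF X])
  show ?thesis
  proof
    show "linear_map_on X X (lam X T)" if "T \<in> orth" for T
      using comp that scaleR_mem[unfolded scaleR_fun_def]
        linear_add[OF orth_linear[OF that]] linear_scale[OF orth_linear[OF that]]
      by (auto simp: linear_map_on_def lam_def fun_eq_iff scaleR_fun_def)
    show "lam X (A \<circ> B) = lam X A \<circ> lam X B" if "A \<in> orth" "B \<in> orth" for A B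
      using comp[OF _ that(2)] linear_0[OF orth_linear[OF that(1)]] by (auto simp: lam_def fun_eq_iff)
    show "L_le 0 (lam X T S)" if "T \<in> pos_orth" "S \<in> X" "L_le 0 S" for T S
      using that pos_orth_nonneg[OF that(1)] by (auto simp: op_le_def lam_def)
  qed (use ppp in \<open>auto simp: lam_def id_op_def fun_eq_iff scaleR_fun_def\<close>)
qed

theorem corollary2p7:
  fixes X :: "('e::archimedean_vector_lattice \<Rightarrow>
               'f::{archimedean_vector_lattice, conditionally_complete_lattice}) set"
  assumes "vector_sublattice L_ob L_le X"
    and "principal_projection_property X L_le"
  shows
    "((\<forall>S\<in>X. \<forall>T\<in>Orth (UNIV :: 'e set) (\<le>). S \<circ> T \<in> X) \<longrightarrow>
        (\<forall>T\<in>Orth (UNIV :: 'e set) (\<le>). rho X T \<in> Orth X L_le) \<and>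
        Orth_hom (UNIV :: 'e set) (\<le>) X L_le (rho X)) \<and>
     ((\<forall>S\<in>X. \<forall>T\<in>Orth (UNIV :: 'f set) (\<le>). T \<circ> S \<in> X) \<longrightarrow>
        (\<forall>T\<in>Orth (UNIV :: 'f set) (\<le>). lam X T \<in> Orth X L_le) \<and>
        Orth_hom (UNIV :: 'f set) (\<le>) X L_le (lam X))"
proof (intro conjI impI)
  assume "\<forall>S\<in>X. \<forall>T\<in>Orth (UNIV :: 'e set) (\<le>). S \<circ> T \<in> X"
  then interpret orth_representation X L_le "rho X"
    using orth_representation_rho[OF assms] by blast
  show "\<forall>T\<in>Orth (UNIV :: 'e set) (\<le>). rho X T \<in> Orth X L_le"
    using h_mem_Orth by blast
  show "Orth_hom (UNIV :: 'e set) (\<le>) X L_le (rho X)"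
    by (rule Orth_hom_h)
next
  assume "\<forall>S\<in>X. \<forall>T\<in>Orth (UNIV :: 'f set) (\<le>). T \<circ> S \<in> X"
  then interpret orth_representation X L_le "lam X"
    using orth_representation_lam[OF assms] by blast
  show "\<forall>T\<in>Orth (UNIV :: 'f set) (\<le>). lam X T \<in> Orth X L_le"
    using h_mem_Orth by blast
  show "Orth_hom (UNIV :: 'f set) (\<le>) X L_le (lam X)"
    by (rule Orth_hom_h)
qed

end
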